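(* Consider the RDAG model on a coloured DAG $(\mathcal{G},c)$ where the colouring $c$ is compatible and $(\mathcal{G},c)$ has no edges between vertices of the same colour. Then $$\max_{s:\ \alpha_s\ge 2}\left(\left\lfloor\frac{r_s-1}{\alpha_s-1}\right\rfloor+1\right)\ \le\ \mathrm{mlt}_e\ \le\ \max_{s}\left\lfloor\frac{\beta_s}{\alpha_s}\right\rfloor+1,$$ $$\max_s\left\lfloor\frac{\beta_s}{\alpha_s}\right\rfloor+1\ \le\ \mathrm{mlt}_u\ \le\ \max_s\,(\beta_s+2-r_s),$$ where $s$ ranges over the vertex colours $c(I)$ (and the lower bound on $\mathrm{mlt}_e$ is vacuous if no $s$ has $\alpha_s\ge 2$).
   Context: $\mathcal{G}=(I,E)$ is a directed acyclic graph (DAG) with vertex set $I=[m]=\{1,\dots,m\}$ and edge set $E$ (no loops, no multiple edges); $j\to i$ denotes an edge from $j$ to $i$. Vertices are ordered so that $j\to i$ implies $j>i$. A coloured DAG $(\mathcal{G},c)$ is a DAG with a map $c: I\cup E\to \mathcal{C}$ to a set of colours; $c(i)$ is the colour of vertex $i$ and $c(ij)$ is the colour of the edge $j\to i$. The colouring $c$ is compatible if (i) vertex colours and edge colours are disjoint, and (ii) whenever edges $j\to i$ and $l\to k$ satisfy $c(ij)=c(kl)$, then $c(i)=c(k)$. The RDAG model on $(\mathcal{G},c)$ is the set of all matrices $\Psi=(\mathrm{id}-\Lambda)^{\mathsf T}\Omega^{-1}(\mathrm{id}-\Lambda)$, where $\Lambda\in\mathbb{R}^{m\times m}$ satisfies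 $\lambda_{ij}=0$ unless $j\to i$ in $\mathcal{G}$ and $\lambda_{ij}=\lambda_{kl}$ whenever edges $j\to i$ and $l\to k$ have the same colour, and $\Omega\in\mathbb{R}^{m\times m}$ is diagonal with positive diagonal entries satisfying $\omega_{ii}=\omega_{jj}$ whenever vertices $i,j$ have the same colour. For a sample matrix $Y\in\mathbb{R}^{m\times n}$ ($n\ge 1$; $Y^{(i)}\in\mathbb{R}^{1\times n}$ is the $i$th row), the log-likelihood is $\ell_Y(\Psi)=\log\det(\Psi)-\mathrm{tr}(\Psi S_Y)$ with $S_Y=\frac1n YY^{\mathsf T}$. An MLE given $Y$ is a maximiser of $\ell_Y$ over the model. $\mathrm{mlt}_e$ (resp. $\mathrm{mlt}_u$) is the minimal number $n$ of samples such that an MLE exists (resp. exists and is unique) for almost all $Y\in\mathbb{R}^{m\times n}$ (Lebesgue measure). For a vertex colour $s\in c(I)$, let $\alpha_s$ be the number of vertices of colour $s$, $\mathrm{prc}(s)=\{c(ij)\mid j\to i \text{ in }\mathcal{G},\ c(i)=s\}$, and $\beta_s=|\mathrm{prc}(s)|$. Let $i_1<\dots<i_{\alpha_s}$ be the vertices of colour $s$. Let $M'_{Y,s}\in\mathbb{R}^{\beta_s\times\alpha_s n}$ be the matrix with rows indexed by $t\in\mathrm{prc}(s)$, each row consisting of $\alpha_s$ blocks of length $n$, where the $k$th block of row $t$ is $\sum_{j:\, j\to i_k,\ c(i_kj)=t} Y^{(j)}$ (zero if the sum is empty). The generic rank of a matrix whose entries are linear combinations of the entries of $Y$ is its rank for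 generic $Y$ (equivalently its rank as a symbolic matrix in indeterminates $Y_{ij}$). $r_s$ denotes the generic rank of $M'_{Y,s}$ when $n=1$. *)

theory Defs
  imports
    "HOL-Library.Extended_Nat"
    "HOL-Analysis.Lebesgue_Measure"
    "Jordan_Normal_Form.Gauss_Jordan_Elimination"
    "Jordan_Normal_Form.DL_Rank"
begin

text \<open>
  The vertex set is \<open>{..<m}\<close>, numbered from 0 to agree with matrix indices. A pair
  \<open>(j, i) \<in> E\<close> is the edge \<open>j \<rightarrow> i\<close>. The colouring of the disjoint union of vertices and
  edges is given by its two restrictions, with a common type of colours: \<open>cv i\<close> is the colour
  of the vertex \<open>i\<close> and \<open>ce (j, i)\<close> the colour of the edge \<open>j \<rightarrow> i\<close>.
\<close>

definition ordered_dag :: "nat \<Rightarrow> (nat \<times> nat) set \<Rightarrow> bool" where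
  "ordered_dag m E \<longleftrightarrow>
     E \<subseteq> {..<m} \<times> {..<m} \<and> acyclic E \<and> (\<forall>(j, i) \<in> E. j > i)"

definition compatible ::
  "nat \<Rightarrow> (nat \<times> nat) set \<Rightarrow> (nat \<Rightarrow> 'c) \<Rightarrow> (nat \<times> nat \<Rightarrow> 'c) \<Rightarrow> bool" where
  "compatible m E cv ce \<longleftrightarrow>
     cv ` {..<m} \<inter> ce ` E = {} \<and>
     (\<forall>(j, i) \<in> E. \<forall>(l, k) \<in> E. ce (j, i) = ce (l, k) \<longrightarrow> cv i = cv k)"


definition rdag_Lambda ::
  "nat \<Rightarrow> (nat \<times> nat) set \<Rightarrow> (nat \<times> nat \<Rightarrow> 'c) \<Rightarrow> real mat set" where
  "rdag_Lambda m E ce = {L \<in> carrier_mat m m.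
     (\<forall>i<m. \<forall>j<m. (j, i) \<notin> E \<longrightarrow> L $$ (i, j) = 0) \<and>
     (\<forall>(j, i) \<in> E. \<forall>(l, k) \<in> E. ce (j, i) = ce (l, k) \<longrightarrow> L $$ (i, j) = L $$ (k, l))}"

definition rdag_Omega :: "nat \<Rightarrow> (nat \<Rightarrow> 'c) \<Rightarrow> real mat set" where
  "rdag_Omega m cv = {W \<in> carrier_mat m m.
     diagonal_mat W \<and> (\<forall>i<m. W $$ (i, i) > 0) \<and>
     (\<forall>i<m. \<forall>j<m. cv i = cv j \<longrightarrow> W $$ (i, i) = W $$ (j, j))}"

definition rdag_model ::
  "nat \<Rightarrow> (nat \<times> nat) set \<Rightarrow> (nat \<Rightarrow> 'c) \<Rightarrow> (nat \<times> nat \<Rightarrow> 'c) \<Rightarrow> real mat set" where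
  "rdag_model m E cv ce =
     {transpose_mat (1\<^sub>m m - L) * the (mat_inverse W) * (1\<^sub>m m - L) | L W.
        L \<in> rdag_Lambda m E ce \<and> W \<in> rdag_Omega m cv}"


definition mat_trace :: "'a::comm_monoid_add mat \<Rightarrow> 'a" where
  "mat_trace A = (\<Sum>i<dim_row A. A $$ (i, i))"

definition sample_cov :: "real mat \<Rightarrow> real mat" where
  "sample_cov Y = (1 / real (dim_col Y)) \<cdot>\<^sub>m (Y * transpose_mat Y)"

definition log_lik :: "real mat \<Rightarrow> real mat \<Rightarrow> real" where
  "log_lik Y P = ln (det P) - mat_trace (P * sample_cov Y)"

definition is_mle :: "real mat set \<Rightarrow> real mat \<Rightarrow> real mat \<Rightarrow> bool" where
  "is_mle M Y P \<longleftrightarrow> is_arg_max (log_lik Y) (\<lambda>Q. Q \<in> M) P"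

definition almost_all_samples :: "nat \<Rightarrow> nat \<Rightarrow> (real mat \<Rightarrow> bool) \<Rightarrow> bool" where
  "almost_all_samples m n Q \<longleftrightarrow>
     (AE y in (\<Pi>\<^sub>M p \<in> {..<m} \<times> {..<n}. (lborel :: real measure)). Q (mat m n y))"

text \<open>The thresholds are \<open>\<infinity>\<close> if no number of samples suffices.\<close>

definition mlt_e ::
  "nat \<Rightarrow> (nat \<times> nat) set \<Rightarrow> (nat \<Rightarrow> 'c) \<Rightarrow> (nat \<times> nat \<Rightarrow> 'c) \<Rightarrow> enat" where
  "mlt_e m E cv ce = Inf {enat n | n. n \<ge> 1 \<and>
     almost_all_samples m n (\<lambda>Y. \<exists>P. is_mle (rdag_model m E cv ce) Y P)}"

definition mlt_u ::
  "nat \<Rightarrow> (nat \<times> nat) set \<Rightarrow> (nat \<Rightarrow> 'c) \<Rightarrow> (nat \<times> nat \<Rightarrow> 'c) \<Rightarrow> enat" where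
  "mlt_u m E cv ce = Inf {enat n | n. n \<ge> 1 \<and>
     almost_all_samples m n (\<lambda>Y. \<exists>!P. is_mle (rdag_model m E cv ce) Y P)}"


definition vertices_of :: "nat \<Rightarrow> (nat \<Rightarrow> 'c) \<Rightarrow> 'c \<Rightarrow> nat set" where
  "vertices_of m cv s = {i \<in> {..<m}. cv i = s}"

definition alpha :: "nat \<Rightarrow> (nat \<Rightarrow> 'c) \<Rightarrow> 'c \<Rightarrow> nat" where
  "alpha m cv s = card (vertices_of m cv s)"

definition prc :: "(nat \<times> nat) set \<Rightarrow> (nat \<Rightarrow> 'c) \<Rightarrow> (nat \<times> nat \<Rightarrow> 'c) \<Rightarrow> 'c \<Rightarrow> 'c set" where
  "prc E cv ce s = {ce (j, i) | j i. (j, i) \<in> E \<and> cv i = s}"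

definition beta :: "(nat \<times> nat) set \<Rightarrow> (nat \<Rightarrow> 'c) \<Rightarrow> (nat \<times> nat \<Rightarrow> 'c) \<Rightarrow> 'c \<Rightarrow> nat" where
  "beta E cv ce s = card (prc E cv ce s)"

text \<open>
  The rows of \<open>M'\<close> are indexed by the set of colours \<open>prc\<close>, which has no preferred
  order, so an arbitrary enumeration is fixed.
\<close>

definition prc_list :: "(nat \<times> nat) set \<Rightarrow> (nat \<Rightarrow> 'c) \<Rightarrow> (nat \<times> nat \<Rightarrow> 'c) \<Rightarrow> 'c \<Rightarrow> 'c list" where
  "prc_list E cv ce s = (SOME ts. distinct ts \<and> set ts = prc E cv ce s)"

text \<open>Column \<open>b\<close> of \<open>M'\<close> is position \<open>b mod n\<close> of block \<open>b div n\<close>, with \<open>n = dim_col Y\<close>.\<close>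

definition M_prime ::
  "nat \<Rightarrow> (nat \<times> nat) set \<Rightarrow> (nat \<Rightarrow> 'c) \<Rightarrow> (nat \<times> nat \<Rightarrow> 'c) \<Rightarrow> 'c \<Rightarrow> real mat \<Rightarrow> real mat" where
  "M_prime m E cv ce s Y =
     (let n = dim_col Y; vs = sorted_list_of_set (vertices_of m cv s); ts = prc_list E cv ce s
      in mat (beta E cv ce s) (alpha m cv s * n)
           (\<lambda>(a, b). \<Sum>j | (j, vs ! (b div n)) \<in> E \<and> ce (j, vs ! (b div n)) = ts ! a.
                       Y $$ (j, b mod n)))"

definition mat_rank :: "'a::field mat \<Rightarrow> nat" where
  "mat_rank A = vec_space.rank (dim_row A) A"


text \<open>
  A property of \<open>m \<times> n\<close> matrices holds generically if it holds outside the zero set of a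
  nonzero polynomial in the entries (over the reals, polynomials may be identified with
  polynomial functions).
\<close>

inductive_set poly_funs :: "nat \<Rightarrow> nat \<Rightarrow> (real mat \<Rightarrow> real) set" for m n where
  const: "(\<lambda>Y. a) \<in> poly_funs m n"
| entry: "i < m \<Longrightarrow> j < n \<Longrightarrow> (\<lambda>Y. Y $$ (i, j)) \<in> poly_funs m n"
| add: "p \<in> poly_funs m n \<Longrightarrow> q \<in> poly_funs m n \<Longrightarrow> (\<lambda>Y. p Y + q Y) \<in> poly_funs m n"
| mult: "p \<in> poly_funs m n \<Longrightarrow> q \<in> poly_funs m n \<Longrightarrow> (\<lambda>Y. p Y * q Y) \<in> poly_funs m n"

definition generically :: "nat \<Rightarrow> nat \<Rightarrow> (real mat \<Rightarrow> bool) \<Rightarrow> bool" where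
  "generically m n Q \<longleftrightarrow>
     (\<exists>p \<in> poly_funs m n. (\<exists>Y \<in> carrier_mat m n. p Y \<noteq> 0) \<and>
        (\<forall>Y \<in> carrier_mat m n. p Y \<noteq> 0 \<longrightarrow> Q Y))"

definition generic_rank :: "nat \<Rightarrow> nat \<Rightarrow> (real mat \<Rightarrow> real mat) \<Rightarrow> nat" where
  "generic_rank m n A = (THE r. generically m n (\<lambda>Y. mat_rank (A Y) = r))"

definition r_gen ::
  "nat \<Rightarrow> (nat \<times> nat) set \<Rightarrow> (nat \<Rightarrow> 'c) \<Rightarrow> (nat \<times> nat \<Rightarrow> 'c) \<Rightarrow> 'c \<Rightarrow> nat" where
  "r_gen m E cv ce s = generic_rank m 1 (M_prime m E cv ce s)"

end

theory Submission
  imports Defs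
begin

unbundle no vec_syntax

text \<open>
  Since the colouring is compatible, every edge colour occurs below vertices of a single colour
  \<open>s\<close>, so minus the log-likelihood splits into a sum of costs, one for each vertex colour:
  \<open>\<alpha>\<^sub>s * ln \<omega>\<^sub>s + \<parallel>y\<^sub>s - \<lambda>\<^sub>s M'\<^sub>s\<parallel>\<^sup>2 / (n * \<omega>\<^sub>s)\<close>. Here \<open>y\<^sub>s\<close> consists of the samples at the vertices
  of colour \<open>s\<close>, a vector of length \<open>\<alpha>\<^sub>s * n\<close>, and \<open>\<lambda>\<^sub>s\<close> of the coefficients of the colours in
  \<open>prc(s)\<close>. Minimising first over \<open>\<lambda>\<^sub>s\<close> (least squares) and then over \<open>\<omega>\<^sub>s\<close> shows that an MLE
  exists iff no \<open>y\<^sub>s\<close> lies in the row span of \<open>M'\<^sub>s\<close> (\<open>mle_exists\<close>, \<open>no_mle_if_in_span\<close>). An MLE that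
  exists is unique iff in addition the rows of every \<open>M'\<^sub>s\<close> are independent.

  There are no edges inside a colour class, so \<open>y\<^sub>s\<close> and \<open>M'\<^sub>s\<close> depend on different sample
  entries. Hence if \<open>\<beta>\<^sub>s < \<alpha>\<^sub>s * n\<close>, then \<open>M'\<^sub>s\<close> has too few rows to span the whole space and a
  generic \<open>y\<^sub>s\<close> avoids its row span (\<open>generically_not_in_span\<close>); this is the upper bound on
  \<open>mlt\<^sub>e\<close>. Conversely, if \<open>\<beta>\<^sub>s \<ge> \<alpha>\<^sub>s * n\<close> then the rows of \<open>M'\<^sub>s\<close> are dependent or span
  everything, so that not for a single \<open>Y\<close> is there exactly one MLE (\<open>unique_mle_imp_beta_less\<close>);
  this is the lower bound on \<open>mlt\<^sub>u\<close>.

  For \<open>n = 1\<close> the matrix \<open>M'\<^sub>s\<close> has \<open>\<alpha>\<^sub>s\<close> columns, so \<open>r\<^sub>s \<le> \<alpha>\<^sub>s\<close> and the lower bound on \<open>mlt\<^sub>e\<close>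
  exceeds \<open>1\<close> only if \<open>r\<^sub>s = \<alpha>\<^sub>s\<close>. In that case the rows of \<open>M'\<^sub>s\<close> generically span everything and
  one sample does not suffice (\<open>r_gen_eq_alpha_in_span\<close>).

  For the upper bound on \<open>mlt\<^sub>u\<close>, one sample gives \<open>r\<^sub>s\<close> independent rows, and each further sample
  can be chosen to make one more row independent of those (\<open>add_sample\<close>). So \<open>\<beta>\<^sub>s + 1 - r\<^sub>s\<close> samples
  make all rows independent, which forces \<open>\<beta>\<^sub>s \<le> \<alpha>\<^sub>s * (\<beta>\<^sub>s + 1 - r\<^sub>s)\<close>, and with one more sample the
  inequality becomes strict.

  Genericity becomes "for almost all samples" because the zero set of a nonzero polynomial is a
  null set (\<open>generically_imp_almost_all\<close>); independence of rows is the nonvanishing of a Gram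
  determinant (\<open>indep_polynomial\<close>).
\<close>

section \<open>Finite families of real vectors\<close>

text \<open>The rows \<open>f t\<close>, \<open>t \<in> T\<close>, regarded as vectors with index set \<open>X\<close>, are linearly independent
  (as a family, so in particular distinct).\<close>

definition indep :: "'x set \<Rightarrow> 't set \<Rightarrow> ('t \<Rightarrow> 'x \<Rightarrow> real) \<Rightarrow> bool" where
  "indep X T f \<longleftrightarrow> (\<forall>c. (\<forall>x\<in>X. (\<Sum>t\<in>T. c t * f t x) = 0) \<longrightarrow> (\<forall>t\<in>T. c t = 0))"

text \<open>On the index set \<open>X\<close>, the vector \<open>g\<close> is a linear combination of the rows \<open>f t\<close>, \<open>t \<in> T\<close>.\<close>

definition in_span :: "'x set \<Rightarrow> 't set \<Rightarrow> ('t \<Rightarrow> 'x \<Rightarrow> real) \<Rightarrow> ('x \<Rightarrow> real) \<Rightarrow> bool" where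
  "in_span X T f g \<longleftrightarrow> (\<exists>c. \<forall>x\<in>X. g x = (\<Sum>t\<in>T. c t * f t x))"

lemma indepD:
  assumes "indep X T f" "\<And>x. x \<in> X \<Longrightarrow> (\<Sum>t\<in>T. c t * f t x) = 0" "t \<in> T"
  shows "c t = 0"
  using assms unfolding indep_def by blast

lemma indepI:
  assumes "\<And>c t. (\<And>x. x \<in> X \<Longrightarrow> (\<Sum>t\<in>T. c t * f t x) = 0) \<Longrightarrow> t \<in> T \<Longrightarrow> c t = 0"
  shows "indep X T f"
  using assms unfolding indep_def by blast

lemma indep_cong:
  assumes "\<And>t x. t \<in> T \<Longrightarrow> x \<in> X \<Longrightarrow> f t x = f' t x"
  shows "indep X T f = indep X T f'"
proof -
  have "(\<Sum>t\<in>T. c t * f t x) = (\<Sum>t\<in>T. c t * f' t x)" if "x \<in> X" for c x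
    using assms that by (intro sum.cong) auto
  hence "(\<forall>x\<in>X. (\<Sum>t\<in>T. c t * f t x) = 0) = (\<forall>x\<in>X. (\<Sum>t\<in>T. c t * f' t x) = 0)" for c by simp
  thus ?thesis unfolding indep_def by simp
qed

lemma indep_subset_cols:
  assumes "indep X T f" "X \<subseteq> X'"
  shows "indep X' T f"
  using assms unfolding indep_def by blast

lemma in_span_mono:
  assumes "in_span X U f g" "U \<subseteq> T" "finite T"
  shows "in_span X T f g"
proof -
  obtain c where c: "\<forall>x\<in>X. g x = (\<Sum>t\<in>U. c t * f t x)" using assms(1) unfolding in_span_def by blast
  have "(\<Sum>t\<in>T. (if t \<in> U then c t else 0) * f t x) = (\<Sum>t\<in>U. c t * f t x)" for x
    using assms by (intro sum.mono_neutral_cong_right) auto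
  thus ?thesis using c unfolding in_span_def by metis
qed

text \<open>Equivalently, a homogeneous system with more unknowns than equations has a nontrivial
  solution; the proof eliminates one equation and one unknown \<open>t0\<close> at a time.\<close>

lemma indep_card_le:
  assumes "finite X" "finite T" "indep X T f"
  shows "card T \<le> card X"
proof (rule ccontr)
  assume "\<not> card T \<le> card X"
  hence "card X < card T" by simp
  from assms(1,2) this have "\<not> indep X T f"
  proof (induction X arbitrary: T f rule: finite_induct)
    case empty
    then obtain t where "t \<in> T" by fastforce
    thus ?case unfolding indep_def by (auto intro!: exI[of _ "\<lambda>_. 1"])
  next
    case (insert x X)
    show ?case
    proof (cases "\<forall>t\<in>T. f t x = 0")
      case True
      have "\<not> indep X T f" using insert by (intro insert.IH) auto
      thus ?thesis using True unfolding indep_def by (auto simp: sum.neutral)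
    next
      case False
      then obtain t0 where t0: "t0 \<in> T" "f t0 x \<noteq> 0" by blast
      define f' where "f' t y = f t y - f t x / f t0 x * f t0 y" for t y
      have "\<not> indep X (T - {t0}) f'"
        using insert t0 by (intro insert.IH) auto
      then obtain c u where c: "\<And>y. y \<in> X \<Longrightarrow> (\<Sum>t\<in>T - {t0}. c t * f' t y) = 0"
        and u: "u \<in> T - {t0}" "c u \<noteq> 0" unfolding indep_def by blast
      define d where "d = (\<lambda>t. if t = t0 then - (\<Sum>t\<in>T - {t0}. c t * f t x) / f t0 x else c t)"
      have eq: "(\<Sum>t\<in>T. d t * f t y) = (\<Sum>t\<in>T - {t0}. c t * f' t y)" for y
      proof -
        have "(\<Sum>t\<in>T. d t * f t y) = d t0 * f t0 y + (\<Sum>t\<in>T - {t0}. d t * f t y)"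
          using t0 insert.prems by (simp add: sum.remove)
        also have "(\<Sum>t\<in>T - {t0}. d t * f t y) = (\<Sum>t\<in>T - {t0}. c t * f t y)"
          by (intro sum.cong) (auto simp: d_def)
        also have "d t0 * f t0 y = (\<Sum>t\<in>T - {t0}. - (c t * (f t x / f t0 x * f t0 y)))"
          by (simp add: d_def sum_negf sum_distrib_right sum_divide_distrib mult.assoc)
        finally show ?thesis unfolding f'_def by (simp add: right_diff_distrib sum.distrib sum_negf sum_subtractf)
      qed
      have "(\<Sum>t\<in>T - {t0}. c t * f' t x) = 0" unfolding f'_def using t0 by simp
      hence "\<forall>y\<in>insert x X. (\<Sum>t\<in>T. d t * f t y) = 0" using eq c by simp
      moreover have "d u \<noteq> 0" "u \<in> T" using u unfolding d_def by auto
      ultimately show ?thesis unfolding indep_def by blast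
    qed
  qed
  thus False using assms(3) by simp
qed

text \<open>In the following two lemmas \<open>case_option g f\<close> is the family \<open>f\<close> with the vector \<open>g\<close> adjoined at
  the new index \<open>None\<close>.\<close>

lemma sum_option:
  assumes "finite T"
  shows "(\<Sum>t\<in>insert None (Some ` T). c t * case_option g f t x) =
     c None * g x + (\<Sum>t\<in>T. c (Some t) * f t (x :: 'x) :: real)"
  using assms by (subst sum.insert) (auto simp: sum.reindex)

lemma indep_option_iff:
  assumes "finite T"
  shows "indep X (insert None (Some ` T)) (case_option g f) \<longleftrightarrow> indep X T f \<and> \<not> in_span X T f g"
    (is "?L \<longleftrightarrow> ?R")
proof
  assume L: ?L
  have "indep X T f"
  proof (rule indepI)
    fix c t assume *: "\<And>x. x \<in> X \<Longrightarrow> (\<Sum>t\<in>T. c t * f t x) = 0" "t \<in> T"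
    have "(\<Sum>t\<in>insert None (Some ` T). case_option 0 c t * case_option g f t x) = 0" if "x \<in> X" for x
      using *(1)[OF that] by (simp only: sum_option[OF assms] option.case mult_zero_left add_0_left)
    from indepD[OF L this, of "Some t"] show "c t = 0" using *(2) by simp
  qed
  moreover have "\<not> in_span X T f g"
  proof
    assume "in_span X T f g"
    then obtain c where c: "\<And>x. x \<in> X \<Longrightarrow> g x = (\<Sum>t\<in>T. c t * f t x)" unfolding in_span_def by blast
    have "(\<Sum>t\<in>insert None (Some ` T). case_option (-1) c t * case_option g f t x) = 0" if "x \<in> X" for x
      using c[OF that] by (simp only: sum_option[OF assms] option.case)
    from indepD[OF L this, of None] show False by simp
  qed
  ultimately show ?R by simp
next
  assume R: ?R
  show ?L
  proof (rule indepI)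
    fix c t assume *: "\<And>x. x \<in> X \<Longrightarrow> (\<Sum>t\<in>insert None (Some ` T). c t * case_option g f t x) = 0"
      and t: "t \<in> insert None (Some ` T)"
    have **: "c None * g x + (\<Sum>t\<in>T. c (Some t) * f t x) = 0" if "x \<in> X" for x
      using *[OF that] assms by (simp only: sum_option)
    have 0: "c None = 0"
    proof (rule ccontr)
      assume nz: "c None \<noteq> 0"
      have "g x = (\<Sum>t\<in>T. - c (Some t) / c None * f t x)" if "x \<in> X" for x
      proof -
        have "g x = - (\<Sum>t\<in>T. c (Some t) * f t x) / c None" using **[OF that] nz by (simp add: field_simps)
        thus ?thesis by (simp add: sum_divide_distrib sum_negf)
      qed
      hence "in_span X T f g" unfolding in_span_def by (intro exI[of _ "\<lambda>t. - c (Some t) / c None"]) auto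
      thus False using R by simp
    qed
    hence "c (Some u) = 0" if "u \<in> T" for u
      using R ** that indepD[of X T f "\<lambda>t. c (Some t)" u] by simp
    thus "c t = 0" using 0 t by auto
  qed
qed

lemma indep_insert_iff:
  assumes "finite T" "u \<notin> T"
  shows "indep X (insert u T) f \<longleftrightarrow> indep X T f \<and> \<not> in_span X T f (f u)"
proof -
  define h where "h = case_option u id"
  have inj: "inj_on h (insert None (Some ` T))" using assms unfolding h_def by (auto simp: inj_on_def)
  have im: "h ` insert None (Some ` T) = insert u T" unfolding h_def by (force simp: image_iff)
  have s: "(\<Sum>t\<in>insert u T. c t * f t x) = (\<Sum>t\<in>insert None (Some ` T). c (h t) * case_option (f u) f t x)" for c x
    unfolding im[symmetric] sum.reindex[OF inj] by (intro sum.cong) (auto simp: h_def)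
  have "indep X (insert u T) f \<longleftrightarrow> indep X (insert None (Some ` T)) (case_option (f u) f)"
  proof
    assume L: "indep X (insert u T) f"
    show "indep X (insert None (Some ` T)) (case_option (f u) f)"
    proof (rule indepI)
      fix c t assume *: "\<And>x. x \<in> X \<Longrightarrow> (\<Sum>t\<in>insert None (Some ` T). c t * case_option (f u) f t x) = 0"
        and t: "t \<in> insert None (Some ` T)"
      define d where "d = c \<circ> the_inv_into (insert None (Some ` T)) h"
      have d: "d (h t) = c t" if "t \<in> insert None (Some ` T)" for t
        unfolding d_def o_def using the_inv_into_f_f[OF inj that] by simp
      have "(\<Sum>t\<in>insert u T. d t * f t x) = 0" if "x \<in> X" for x
        using *[OF that] d unfolding s by (simp only: cong: sum.cong)
      from indepD[OF L this, of "h t"] show "c t = 0" using d[OF t] im t by auto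
    qed
  next
    assume R: "indep X (insert None (Some ` T)) (case_option (f u) f)"
    show "indep X (insert u T) f"
    proof (rule indepI)
      fix c t assume "\<And>x. x \<in> X \<Longrightarrow> (\<Sum>t\<in>insert u T. c t * f t x) = 0" and t: "t \<in> insert u T"
      hence *: "c (h v) = 0" if "v \<in> insert None (Some ` T)" for v
        using indepD[OF R _ that, of "c \<circ> h"] unfolding s by simp
      obtain v where "v \<in> insert None (Some ` T)" "t = h v" using t unfolding im[symmetric] by (rule imageE)
      thus "c t = 0" using * by simp
    qed
  qed
  thus ?thesis using indep_option_iff[OF assms(1)] by simp
qed

lemma in_span_if_indep_card:
  assumes "finite X" "finite T" "indep X T f" "card X \<le> card T"
  shows "in_span X T f g"
proof (rule ccontr)
  assume "\<not> in_span X T f g"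
  hence "indep X (insert None (Some ` T)) (case_option g f)" using assms by (simp add: indep_option_iff)
  from indep_card_le[OF assms(1) _ this] show False
    using assms by (simp add: card_image)
qed

text \<open>If all unit vectors were in the span, their coefficient vectors, being too many, would be
  dependent, and the same dependency would hold between the unit vectors.\<close>

lemma exists_not_in_span:
  assumes "finite X" "finite T" "card T < card X"
  shows "\<exists>g. \<not> in_span X T f g"
proof (rule ccontr)
  assume "\<nexists>g. \<not> in_span X T f g"
  hence "in_span X T f (\<lambda>x. if x = y then 1 else 0)" for y by blast
  hence "\<forall>y. \<exists>c. \<forall>x\<in>X. (if x = y then 1 else 0) = (\<Sum>t\<in>T. c t * f t x)"
    unfolding in_span_def by blast
  then obtain a where a: "\<And>y x. x \<in> X \<Longrightarrow> (if x = y then 1 else 0) = (\<Sum>t\<in>T. a y t * f t x)" by metis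
  have "\<not> indep T X a" using indep_card_le[OF assms(2,1), of a] assms(3) by auto
  then obtain c u where c: "\<And>t. t \<in> T \<Longrightarrow> (\<Sum>y\<in>X. c y * a y t) = 0" and u: "u \<in> X" "c u \<noteq> 0"
    unfolding indep_def by blast
  have "c u = (\<Sum>y\<in>X. c y * (if u = y then 1 else 0))" using u assms(1)
    by (subst sum.remove[OF assms(1) u(1)]) (auto simp: sum.neutral)
  also have "\<dots> = (\<Sum>y\<in>X. \<Sum>t\<in>T. c y * a y t * f t u)" using a[OF u(1)] by (simp add: sum_distrib_left mult.assoc)
  also have "\<dots> = (\<Sum>t\<in>T. (\<Sum>y\<in>X. c y * a y t) * f t u)"
    by (subst sum.swap) (simp add: sum_distrib_right)
  also have "\<dots> = 0" using c by simp
  finally show False using u by simp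
qed

lemma in_span_trans:
  assumes "finite T" "in_span X U f g" "\<And>u. u \<in> U \<Longrightarrow> in_span X T f (f u)"
  shows "in_span X T f g"
proof -
  obtain c where c: "\<forall>x\<in>X. g x = (\<Sum>u\<in>U. c u * f u x)" using assms(2) unfolding in_span_def by blast
  have "\<forall>u\<in>U. \<exists>a. \<forall>x\<in>X. f u x = (\<Sum>t\<in>T. a t * f t x)" using assms(3) unfolding in_span_def by blast
  then obtain a where a: "\<And>u x. u \<in> U \<Longrightarrow> x \<in> X \<Longrightarrow> f u x = (\<Sum>t\<in>T. a u t * f t x)" by metis
  have "g x = (\<Sum>t\<in>T. (\<Sum>u\<in>U. c u * a u t) * f t x)" if "x \<in> X" for x
  proof -
    have "g x = (\<Sum>u\<in>U. \<Sum>t\<in>T. c u * a u t * f t x)" using c a that by (simp add: sum_distrib_left mult.assoc)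
    thus ?thesis by (subst (asm) sum.swap) (simp add: sum_distrib_right)
  qed
  thus ?thesis unfolding in_span_def by (intro exI[of _ "\<lambda>t. \<Sum>u\<in>U. c u * a u t"]) auto
qed

lemma in_span_self: "finite T \<Longrightarrow> u \<in> T \<Longrightarrow> in_span X T f (f u)"
  unfolding in_span_def
  by (intro exI[of _ "\<lambda>t. if t = u then 1 else 0"] ballI, subst sum.remove[of _ u]) (auto simp: sum.neutral)

lemma in_span_maximal:
  assumes "finite U" "T \<subseteq> U" "indep X T f"
    and "\<And>u. u \<in> U - T \<Longrightarrow> \<not> indep X (insert u T) f"
    and "in_span X U f g"
  shows "in_span X T f g"
proof (rule in_span_trans[OF _ assms(5)])
  show fin: "finite T" using assms finite_subset by blast
  show "in_span X T f (f u)" if "u \<in> U" for u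
    using that assms(3) assms(4)[of u] fin by (cases "u \<in> T") (auto simp: in_span_self indep_insert_iff)
qed

text \<open>This needs no independence of the rows. By induction on \<open>T\<close> as in the Gram--Schmidt process:
  the new row \<open>f v\<close> only contributes through its component \<open>h\<close> orthogonal to the earlier rows.\<close>

lemma normal_equations_solvable:
  assumes "finite T" "finite X"
  shows "\<exists>c. \<forall>u\<in>T. (\<Sum>x\<in>X. (g x - (\<Sum>t\<in>T. c t * f t x)) * f u x) = (0::real)"
  using assms(1)
proof (induction T arbitrary: g rule: finite_induct)
  case (insert v T)
  obtain c where c: "\<forall>u\<in>T. (\<Sum>x\<in>X. (g x - (\<Sum>t\<in>T. c t * f t x)) * f u x) = 0"
    using insert.IH[of g] by blast
  obtain d where d: "\<forall>u\<in>T. (\<Sum>x\<in>X. (f v x - (\<Sum>t\<in>T. d t * f t x)) * f u x) = 0"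
    using insert.IH[of "f v"] by blast
  define g1 where "g1 x = g x - (\<Sum>t\<in>T. c t * f t x)" for x
  define h where "h x = f v x - (\<Sum>t\<in>T. d t * f t x)" for x
  \<comment> \<open>If \<open>h\<close> vanishes on \<open>X\<close>, then the denominator is \<open>0\<close> and hence \<open>k = 0\<close>.\<close>
  define k where "k = (\<Sum>x\<in>X. g1 x * h x) / (\<Sum>x\<in>X. h x * h x)"
  define e where "e t = (if t = v then k else c t - k * d t)" for t
  have res: "g x - (\<Sum>t\<in>insert v T. e t * f t x) = g1 x - k * h x" for x
  proof -
    have "(\<Sum>t\<in>insert v T. e t * f t x) = k * f v x + (\<Sum>t\<in>T. (c t - k * d t) * f t x)"
      using insert.hyps by (auto simp: e_def intro!: sum.cong)
    thus ?thesis unfolding g1_def h_def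
      by (simp add: left_diff_distrib right_diff_distrib sum_subtractf sum_distrib_left mult.assoc)
  qed
  have orthT: "(\<Sum>x\<in>X. (g1 x - k * h x) * f u x) = 0" if "u \<in> T" for u
  proof -
    have "(\<Sum>x\<in>X. (g1 x - k * h x) * f u x) = (\<Sum>x\<in>X. g1 x * f u x) - k * (\<Sum>x\<in>X. h x * f u x)"
      by (simp add: left_diff_distrib sum_subtractf sum_distrib_left mult.assoc)
    thus ?thesis using c d that unfolding g1_def h_def by simp
  qed
  have orthh: "(\<Sum>x\<in>X. (g1 x - k * h x) * h x) = 0"
  proof (cases "(\<Sum>x\<in>X. h x * h x) = 0")
    case True
    hence "\<forall>x\<in>X. h x = 0" using assms(2) by (subst (asm) sum_nonneg_eq_0_iff) auto
    thus ?thesis by simp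
  next
    case False
    have "(\<Sum>x\<in>X. (g1 x - k * h x) * h x) = (\<Sum>x\<in>X. g1 x * h x) - k * (\<Sum>x\<in>X. h x * h x)"
      by (simp add: left_diff_distrib sum_subtractf sum_distrib_left mult.assoc)
    thus ?thesis using False unfolding k_def by simp
  qed
  have "(\<Sum>x\<in>X. (g1 x - k * h x) * f v x) = 0"
  proof -
    have "(\<Sum>x\<in>X. (g1 x - k * h x) * f v x) =
        (\<Sum>x\<in>X. (g1 x - k * h x) * h x) + (\<Sum>x\<in>X. (g1 x - k * h x) * (\<Sum>t\<in>T. d t * f t x))"
      unfolding h_def by (simp add: sum.distrib[symmetric] algebra_simps)
    also have "(\<Sum>x\<in>X. (g1 x - k * h x) * (\<Sum>t\<in>T. d t * f t x)) =
        (\<Sum>t\<in>T. d t * (\<Sum>x\<in>X. (g1 x - k * h x) * f t x))"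
      by (simp add: sum_distrib_left) (subst sum.swap, simp add: algebra_simps)
    finally show ?thesis using orthh orthT by simp
  qed
  thus ?case using orthT by (intro exI[of _ e]) (auto simp: res)
qed auto

text \<open>By the theorem of Pythagoras, a solution \<open>c\<close> of the normal equations minimises the sum of
  squares, and a second minimiser differs from it by a dependency between the rows.\<close>

lemma least_squares_exists:
  assumes "finite T" "finite X"
  shows "\<exists>c. \<forall>c'. (\<Sum>x\<in>X. (g x - (\<Sum>t\<in>T. c' t * f t x))\<^sup>2) =
     (\<Sum>x\<in>X. (g x - (\<Sum>t\<in>T. c t * f t x))\<^sup>2) + (\<Sum>x\<in>X. (\<Sum>t\<in>T. (c' t - c t) * f t x)\<^sup>2 :: real)"
proof -
  obtain c where c: "\<forall>u\<in>T. (\<Sum>x\<in>X. (g x - (\<Sum>t\<in>T. c t * f t x)) * f u x) = 0"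
    using normal_equations_solvable[OF assms, of g f] by blast
  show ?thesis
  proof (intro exI[of _ c] allI)
    fix c'
    define r where "r x = g x - (\<Sum>t\<in>T. c t * f t x)" for x
    define w where "w x = (\<Sum>t\<in>T. (c' t - c t) * f t x)" for x
    have "(\<Sum>x\<in>X. r x * w x) = (\<Sum>t\<in>T. (c' t - c t) * (\<Sum>x\<in>X. r x * f t x))"
      unfolding w_def by (simp add: sum_distrib_left) (subst sum.swap, simp add: algebra_simps)
    also have "\<dots> = 0" using c unfolding r_def by simp
    finally have 0: "(\<Sum>x\<in>X. r x * w x) = 0" .
    have "g x - (\<Sum>t\<in>T. c' t * f t x) = r x - w x" for x
      unfolding r_def w_def by (simp add: left_diff_distrib sum_subtractf)
    hence "(\<Sum>x\<in>X. (g x - (\<Sum>t\<in>T. c' t * f t x))\<^sup>2) = (\<Sum>x\<in>X. (r x)\<^sup>2 + (w x)\<^sup>2 - 2 * (r x * w x))"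
      by (simp only: power2_diff mult.assoc)
    also have "\<dots> = (\<Sum>x\<in>X. (r x)\<^sup>2) + (\<Sum>x\<in>X. (w x)\<^sup>2)"
      using 0 by (simp add: sum_subtractf sum.distrib flip: sum_distrib_left)
    finally show "(\<Sum>x\<in>X. (g x - (\<Sum>t\<in>T. c' t * f t x))\<^sup>2) =
     (\<Sum>x\<in>X. (g x - (\<Sum>t\<in>T. c t * f t x))\<^sup>2) + (\<Sum>x\<in>X. (\<Sum>t\<in>T. (c' t - c t) * f t x)\<^sup>2)"
      unfolding r_def w_def .
  qed
qed

section \<open>Polynomial functions and null sets\<close>

lemma poly_funs_sum:
  assumes "\<And>i. i \<in> I \<Longrightarrow> (\<lambda>Y. p i Y) \<in> poly_funs m n"
  shows "(\<lambda>Y. \<Sum>i\<in>I. p i Y) \<in> poly_funs m n"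
  using assms by (induction I rule: infinite_finite_induct) (auto intro: poly_funs.intros)

lemma poly_funs_prod:
  assumes "\<And>i. i \<in> I \<Longrightarrow> (\<lambda>Y. p i Y) \<in> poly_funs m n"
  shows "(\<lambda>Y. \<Prod>i\<in>I. p i Y) \<in> poly_funs m n"
  using assms by (induction I rule: infinite_finite_induct) (auto intro: poly_funs.intros)

text \<open>The polynomial is the determinant of the Gram matrix of the rows \<open>f Y t\<close>, \<open>t \<in> T\<close>.\<close>

lemma indep_polynomial:
  assumes "finite T" and poly: "\<And>t x. t \<in> T \<Longrightarrow> x \<in> X \<Longrightarrow> (\<lambda>Y. f Y t x) \<in> poly_funs m n"
    and "finite X"
  obtains p where "p \<in> poly_funs m n" "\<And>Y. p Y \<noteq> 0 \<longleftrightarrow> indep X T (f Y)"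
proof -
  define k where "k = card T"
  obtain h where h: "bij_betw h {0..<k} T"
    using ex_bij_betw_nat_finite[OF assms(1)] unfolding k_def by blast
  have hT: "h a \<in> T" if "a < k" for a using h that by (auto simp: bij_betw_def)
  define G where "G Y = mat k k (\<lambda>(a, b). \<Sum>x\<in>X. f Y (h a) x * f Y (h b) x)" for Y
  have G: "G Y \<in> carrier_mat k k" for Y unfolding G_def by simp
  have reindex: "(\<Sum>a\<in>{0..<k}. g (h a)) = (\<Sum>t\<in>T. g t)" for g :: "_ \<Rightarrow> real"
    using sum.reindex_bij_betw[OF h] .
  have mv: "(G Y *\<^sub>v v) $ a = (\<Sum>x\<in>X. f Y (h a) x * (\<Sum>b = 0..<k. v $ b * f Y (h b) x))"
    if "v \<in> carrier_vec k" "a < k" for Y v a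
  proof -
    have "(G Y *\<^sub>v v) $ a = (\<Sum>b = 0..<k. (\<Sum>x\<in>X. f Y (h a) x * f Y (h b) x) * v $ b)"
      using that by (simp add: G_def mult_mat_vec_def scalar_prod_def)
    also have "\<dots> = (\<Sum>b = 0..<k. \<Sum>x\<in>X. f Y (h a) x * (v $ b * f Y (h b) x))"
      by (simp add: sum_distrib_right sum_distrib_left mult_ac)
    also have "\<dots> = (\<Sum>x\<in>X. \<Sum>b = 0..<k. f Y (h a) x * (v $ b * f Y (h b) x))" by (rule sum.swap)
    finally show ?thesis by (simp add: sum_distrib_left)
  qed
  have "det (G Y) \<noteq> 0 \<longleftrightarrow> indep X T (f Y)" for Y
  proof
    assume det: "det (G Y) \<noteq> 0"
    show "indep X T (f Y)"
    proof (rule indepI)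
      fix c t assume c: "\<And>x. x \<in> X \<Longrightarrow> (\<Sum>t\<in>T. c t * f Y t x) = 0" and t: "t \<in> T"
      define v where "v = vec k (\<lambda>a. c (h a))"
      have v: "v \<in> carrier_vec k" unfolding v_def by simp
      have "(\<Sum>b = 0..<k. v $ b * f Y (h b) x) = (\<Sum>t\<in>T. c t * f Y t x)" for x
        unfolding reindex[symmetric] by (intro sum.cong) (auto simp: v_def)
      hence "G Y *\<^sub>v v = 0\<^sub>v k" using mv[OF v] c carrier_matD[OF G] by (intro eq_vecI) auto
      hence "v = 0\<^sub>v k" using det_0_iff_vec_prod_zero_field[OF G] det v by blast
      moreover obtain a where "a < k" "t = h a" using h t by (auto simp: bij_betw_def)
      ultimately show "c t = 0" unfolding v_def by (metis index_vec index_zero_vec(1))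
    qed
  next
    assume ind: "indep X T (f Y)"
    show "det (G Y) \<noteq> 0"
    proof
      assume "det (G Y) = 0"
      then obtain v where v: "v \<in> carrier_vec k" "v \<noteq> 0\<^sub>v k" "G Y *\<^sub>v v = 0\<^sub>v k"
        using det_0_iff_vec_prod_zero_field[OF G] by blast
      define w where "w x = (\<Sum>b = 0..<k. v $ b * f Y (h b) x)" for x
      have "0 = (\<Sum>a = 0..<k. v $ a * (G Y *\<^sub>v v) $ a)" using v by simp
      also have "\<dots> = (\<Sum>a = 0..<k. \<Sum>x\<in>X. v $ a * f Y (h a) x * w x)"
        using mv[OF v(1)] by (intro sum.cong) (auto simp: w_def sum_distrib_left mult.assoc)
      also have "\<dots> = (\<Sum>x\<in>X. \<Sum>a = 0..<k. v $ a * f Y (h a) x * w x)" by (rule sum.swap)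
      also have "\<dots> = (\<Sum>x\<in>X. w x * w x)" by (simp add: w_def sum_distrib_right)
      finally have "\<forall>x\<in>X. w x = 0"
        using assms(3) by (subst (asm) eq_commute, subst (asm) sum_nonneg_eq_0_iff) auto
      define c where "c = (\<lambda>t. v $ the_inv_into {0..<k} h t)"
      have ch: "c (h a) = v $ a" if "a < k" for a
        unfolding c_def using h that by (simp add: the_inv_into_f_f bij_betw_def)
      have "(\<Sum>t\<in>T. c t * f Y t x) = w x" for x
        unfolding reindex[symmetric] w_def by (intro sum.cong) (auto simp: ch)
      hence "c t = 0" if "t \<in> T" for t using indepD[OF ind _ that] \<open>\<forall>x\<in>X. w x = 0\<close> by simp
      hence "v $ a = 0" if "a < k" for a using ch[OF that] hT[OF that] by simp
      hence "v = 0\<^sub>v k" using v(1) by (intro eq_vecI) auto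
      thus False using v by simp
    qed
  qed
  moreover have "(\<lambda>Y. det (G Y)) \<in> poly_funs m n"
  proof -
    have "(\<lambda>Y. \<Sum>\<pi> | \<pi> permutes {0..<k}. signof \<pi> * (\<Prod>a = 0..<k. \<Sum>x\<in>X. f Y (h a) x * f Y (h (\<pi> a)) x))
        \<in> poly_funs m n" (is "?q \<in> _")
    proof (intro poly_funs_sum poly_funs.mult poly_funs.const poly_funs_prod poly)
      fix \<pi> a assume "\<pi> \<in> {\<pi>. \<pi> permutes {0..<k}}" "a \<in> {0..<k}"
      thus "h a \<in> T" "h (\<pi> a) \<in> T" using hT permutes_in_image[of \<pi> "{0..<k}" a] by auto
    qed
    moreover have "det (G Y) = ?q Y" for Y
      unfolding det_def'[OF G]
    proof (intro sum.cong arg_cong2[where f = "(*)"] prod.cong refl)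
      fix \<pi> a assume "\<pi> \<in> {\<pi>. \<pi> permutes {0..<k}}" "a \<in> {0..<k}"
      thus "G Y $$ (a, \<pi> a) = (\<Sum>x\<in>X. f Y (h a) x * f Y (h (\<pi> a)) x)"
        using permutes_in_image[of \<pi> "{0..<k}" a] by (simp add: G_def)
    qed
    ultimately show ?thesis by simp
  qed
  ultimately show thesis by (intro that[of "\<lambda>Y. det (G Y)"])
qed

lemma poly_funs_univariate:
  assumes "p \<in> poly_funs m n"
  shows "\<exists>P. \<forall>x. p (mat m n (w(i := x))) = poly P x"
  using assms
proof induction
  case (const a)
  show ?case by (rule exI[of _ "[:a:]"]) simp
next
  case (entry k l)
  thus ?case by (cases "i = (k, l)") (auto intro: exI[of _ "[:0, 1:]"] exI[of _ "[:w (k, l):]"])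
next
  case (add p q)
  thus ?case by (metis poly_add)
next
  case (mult p q)
  thus ?case by (metis poly_mult)
qed

lemma poly_funs_measurable:
  assumes "p \<in> poly_funs m n"
  shows "(\<lambda>y. p (mat m n (\<lambda>i. if i \<in> I then y i else z i))) \<in> borel_measurable (\<Pi>\<^sub>M i\<in>I. (lborel :: real measure))"
  using assms
proof induction
  case (entry k l)
  show ?case
  proof (cases "(k, l) \<in> I")
    case True
    have "(\<lambda>y. y (k, l)) \<in> measurable (\<Pi>\<^sub>M i\<in>I. (lborel :: real measure)) lborel"
      by (rule measurable_component_singleton[OF True])
    thus ?thesis using entry True by simp
  qed (use entry in simp)
qed auto

text \<open>By induction on the coordinates that are integrated, the others being fixed at \<open>z\<close>:
  for almost all values of the earlier coordinates, a polynomial in the new one is nonzero.\<close>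

lemma poly_funs_AE_nonzero:
  assumes p: "p \<in> poly_funs m n" and "finite I"
    and "p (mat m n (\<lambda>i. if i \<in> I then y0 i else z i)) \<noteq> 0"
  shows "AE y in (\<Pi>\<^sub>M i\<in>I. (lborel :: real measure)). p (mat m n (\<lambda>i. if i \<in> I then y i else z i)) \<noteq> 0"
  using assms(2,3)
proof (induction I arbitrary: z rule: finite_induct)
  case empty
  thus ?case by simp
next
  case (insert i I)
  interpret product_sigma_finite "\<lambda>_. lborel :: real measure" by standard
  let ?q = "\<lambda>y. p (mat m n (\<lambda>j. if j \<in> insert i I then y j else z j))"
  let ?ind = "\<lambda>y. indicator {0} (?q y) :: ennreal"
  have q[measurable]: "?q \<in> borel_measurable (\<Pi>\<^sub>M i\<in>insert i I. (lborel :: real measure))"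
    using p by (rule poly_funs_measurable)
  have meas: "?ind \<in> borel_measurable (\<Pi>\<^sub>M i\<in>insert i I. (lborel :: real measure))" by measurable
  have upd: "(\<lambda>j. if j \<in> insert i I then (y(i := x)) j else z j) =
      (\<lambda>j. if j \<in> I then y j else z j)(i := x)" for y x
    using insert.hyps by auto
  have upd': "(\<lambda>j. if j \<in> I then y j else (z(i := x)) j) =
      (\<lambda>j. if j \<in> I then y j else z j)(i := x)" for y x
    using insert.hyps by auto
  have "p (mat m n (\<lambda>j. if j \<in> I then y0 j else (z(i := y0 i)) j)) \<noteq> 0"
    using insert.prems upd[of y0 "y0 i"] unfolding upd' fun_upd_triv by simp
  from insert.IH[OF this]
  have AE: "AE y in (\<Pi>\<^sub>M i\<in>I. lborel). p (mat m n ((\<lambda>j. if j \<in> I then y j else z j)(i := y0 i))) \<noteq> 0"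
    unfolding upd' .
  have inner: "(\<integral>\<^sup>+ x. ?ind (y(i := x)) \<partial>lborel) = 0"
    if nz: "p (mat m n ((\<lambda>j. if j \<in> I then y j else z j)(i := y0 i))) \<noteq> 0" for y
  proof -
    obtain P where P: "\<And>x. p (mat m n ((\<lambda>j. if j \<in> I then y j else z j)(i := x))) = poly P x"
      using poly_funs_univariate[OF p] by blast
    hence "P \<noteq> 0" using nz by auto
    hence "finite {x. poly P x = 0}" by (rule poly_roots_finite)
    hence "AE x in lborel. x \<notin> {x. poly P x = 0}"
      by (intro AE_not_in) (simp add: finite_imp_null_set_lborel)
    hence "AE x in lborel. ?ind (y(i := x)) = 0"
      unfolding upd P by (auto simp: indicator_def)
    thus ?thesis by (subst nn_integral_cong_AE[where v = "\<lambda>_. 0"]) auto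
  qed
  have "(\<integral>\<^sup>+ y. ?ind y \<partial>(\<Pi>\<^sub>M i\<in>insert i I. lborel)) = (\<integral>\<^sup>+ y. \<integral>\<^sup>+ x. ?ind (y(i := x)) \<partial>lborel \<partial>(\<Pi>\<^sub>M i\<in>I. lborel))"
    using insert.hyps meas by (rule product_nn_integral_insert)
  also have "\<dots> = (\<integral>\<^sup>+ y. 0 \<partial>(\<Pi>\<^sub>M i\<in>I. (lborel :: real measure)))"
    using AE inner by (intro nn_integral_cong_AE) (auto elim!: eventually_mono)
  finally have "(\<integral>\<^sup>+ y. ?ind y \<partial>(\<Pi>\<^sub>M i\<in>insert i I. lborel)) = 0" by simp
  hence "AE y in (\<Pi>\<^sub>M i\<in>insert i I. lborel). ?ind y = 0"
    using nn_integral_0_iff_AE[OF meas] by simp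
  thus ?case by (auto elim!: eventually_mono simp: indicator_def split: if_splits)
qed

lemma generically_imp_almost_all:
  assumes "generically m n Q"
  shows "almost_all_samples m n Q"
proof -
  obtain p Y0 where p: "p \<in> poly_funs m n" "Y0 \<in> carrier_mat m n" "p Y0 \<noteq> 0"
    and Q: "\<And>Y. Y \<in> carrier_mat m n \<Longrightarrow> p Y \<noteq> 0 \<Longrightarrow> Q Y"
    using assms unfolding generically_def by blast
  let ?I = "{..<m} \<times> {..<n}"
  have restr: "mat m n (\<lambda>i. if i \<in> ?I then y i else 0) = mat m n y" for y :: "nat \<times> nat \<Rightarrow> real"
    by (intro cong_mat) auto
  have "mat m n (\<lambda>i. Y0 $$ i) = Y0" using p(2) by (intro eq_matI) auto
  hence "p (mat m n (\<lambda>i. if i \<in> ?I then Y0 $$ i else 0)) \<noteq> 0" using p(3) unfolding restr by simp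
  from poly_funs_AE_nonzero[OF p(1) _ this]
  have "AE y in (\<Pi>\<^sub>M i\<in>?I. lborel). p (mat m n y) \<noteq> 0" unfolding restr by simp
  thus ?thesis unfolding almost_all_samples_def by (auto elim!: eventually_mono intro: Q)
qed

lemma almost_all_conj:
  "almost_all_samples m n P \<Longrightarrow> almost_all_samples m n Q \<Longrightarrow> almost_all_samples m n (\<lambda>Y. P Y \<and> Q Y)"
  unfolding almost_all_samples_def by auto

lemma almost_all_ball:
  "finite S \<Longrightarrow> (\<And>s. s \<in> S \<Longrightarrow> almost_all_samples m n (P s)) \<Longrightarrow> almost_all_samples m n (\<lambda>Y. \<forall>s\<in>S. P s Y)"
  unfolding almost_all_samples_def by (subst AE_ball_countable) (auto intro: countable_finite)

lemma almost_all_mono: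
  assumes "almost_all_samples m n P" "\<And>Y. Y \<in> carrier_mat m n \<Longrightarrow> P Y \<Longrightarrow> Q Y"
  shows "almost_all_samples m n Q"
  using assms unfolding almost_all_samples_def by (auto elim!: eventually_mono)

text \<open>The space of samples is not a null set: its unit cube has measure \<open>1\<close>.\<close>

lemma almost_all_imp_ex:
  assumes "almost_all_samples m n Q"
  shows "\<exists>Y\<in>carrier_mat m n. Q Y"
proof (rule ccontr)
  assume none: "\<not> ?thesis"
  interpret product_sigma_finite "\<lambda>_. lborel :: real measure" by standard
  let ?I = "{..<m} \<times> {..<n}"
  let ?M = "\<Pi>\<^sub>M i\<in>?I. (lborel :: real measure)"
  have "AE y in ?M. False"
    using assms none unfolding almost_all_samples_def by (auto elim!: eventually_mono)
  hence "emeasure ?M (space ?M) = 0" by (simp add: AE_iff_measurable[OF _ refl])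
  moreover have "emeasure ?M (Pi\<^sub>E ?I (\<lambda>_. {0..1})) = 1"
    by (subst emeasure_PiM) auto
  moreover have "emeasure ?M (Pi\<^sub>E ?I (\<lambda>_. {0..1})) \<le> emeasure ?M (space ?M)"
    by (intro emeasure_mono sets.top) (auto simp: space_PiM)
  ultimately show False by simp
qed

section \<open>Rank and generic rank\<close>

text \<open>Row rank equals column rank. The rank is the size of a maximal independent set \<open>S\<close> of columns.
  These span all columns, so restricting the rows to \<open>S\<close> preserves all linear relations between
  them; comparing \<open>S\<close> with a maximal independent set \<open>R\<close> of rows gives both inequalities.\<close>

lemma mat_rank_indep_rows:
  fixes A :: "real mat"
  assumes "A \<in> carrier_mat k l"
  obtains R where "R \<subseteq> {..<k}" "card R = mat_rank A" "indep {..<l} R (\<lambda>a b. A $$ (a, b))"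
    "\<forall>T\<subseteq>{..<k}. indep {..<l} T (\<lambda>a b. A $$ (a, b)) \<longrightarrow> card T \<le> mat_rank A"
proof -
  interpret vec_space "TYPE(real)" k .
  obtain S where S: "maximal S (\<lambda>T. T \<subseteq> set (cols A) \<and> lin_indpt T)"
    using maximal_exists[of "(\<lambda>T. T \<subseteq> set (cols A) \<and> lin_indpt T)" "card (set (cols A))" "{}"]
    by (meson List.finite_set card_mono empty_iff empty_subsetI finite_lin_indpt2 rev_finite_subset)
  have rank: "mat_rank A = card S"
    unfolding mat_rank_def using rank_card_indpt[OF assms S] assms by simp
  have Scols: "S \<subseteq> set (cols A)" and Sind: "lin_indpt S"
    and Smax: "\<And>T. S \<subseteq> T \<Longrightarrow> T \<subseteq> set (cols A) \<Longrightarrow> lin_indpt T \<Longrightarrow> S = T"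
    using S unfolding maximal_def by auto
  have carr: "set (cols A) \<subseteq> carrier_vec k" using assms cols_dim by blast
  have finS: "finite S" using Scols finite_subset by blast
  have lin: "lin_indpt T \<longleftrightarrow> indep {..<k} T (\<lambda>v i. v $ i)" if T: "T \<subseteq> set (cols A)" for T
  proof -
    have Tc: "T \<subseteq> carrier_vec k" and fin: "finite T" using T carr finite_subset by blast+
    have z: "lincomb c T = 0\<^sub>v k \<longleftrightarrow> (\<forall>i<k. (\<Sum>v\<in>T. c v * v $ i) = 0)" for c
    proof
      assume "lincomb c T = 0\<^sub>v k"
      thus "\<forall>i<k. (\<Sum>v\<in>T. c v * v $ i) = 0" using lincomb_index[OF _ Tc] by (metis index_zero_vec(1))
    next
      assume "\<forall>i<k. (\<Sum>v\<in>T. c v * v $ i) = 0"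
      thus "lincomb c T = 0\<^sub>v k"
        using lincomb_dim[OF fin Tc] by (intro eq_vecI) (auto simp: lincomb_index[OF _ Tc])
    qed
    show ?thesis
    proof
      assume "lin_indpt T"
      thus "indep {..<k} T (\<lambda>v i. v $ i)"
        using lin_dep_crit[OF fin subset_refl _ _ ] z fin unfolding indep_def
        by (metis lessThan_iff Pi_UNIV UNIV_I lin_dep_def order_refl)
    next
      assume ind: "indep {..<k} T (\<lambda>v i. v $ i)"
      show "lin_indpt T"
      proof
        assume "lin_dep T"
        then obtain c v where "lincomb c T = 0\<^sub>v k" "v \<in> T" "c v \<noteq> 0"
          using finite_lin_dep[OF fin _ Tc] by blast
        thus False using z[of c] indepD[OF ind, of c v] by simp
      qed
    qed
  qed
  have colspan: "in_span {..<k} S (\<lambda>v i. v $ i) (\<lambda>i. A $$ (i, b))" if b: "b < l" for b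
  proof -
    have col: "col A b \<in> set (cols A)" using b assms by (auto simp: cols_def)
    have "in_span {..<k} S (\<lambda>v i. v $ i) (\<lambda>i. col A b $ i)"
    proof (cases "col A b \<in> S")
      case True
      thus ?thesis using in_span_self[OF finS True, of "{..<k}" "\<lambda>v i. v $ i"] by simp
    next
      case False
      hence "\<not> lin_indpt (insert (col A b) S)" using Smax[of "insert (col A b) S"] Scols col by blast
      hence "\<not> indep {..<k} (insert (col A b) S) (\<lambda>v i. v $ i)" using lin Scols col by auto
      thus ?thesis using indep_insert_iff[OF finS False] lin[OF Scols] Sind by blast
    qed
    thus ?thesis using assms b unfolding in_span_def by simp
  qed
  then obtain a where a: "\<And>i b. b < l \<Longrightarrow> i < k \<Longrightarrow> A $$ (i, b) = (\<Sum>v\<in>S. a b v * v $ i)"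
    unfolding in_span_def by (metis lessThan_iff)
  have col_entry: "\<exists>b<l. \<forall>i<k. v $ i = A $$ (i, b)" if "v \<in> S" for v
  proof -
    have "v \<in> set (cols A)" using that Scols by blast
    then obtain b where "b < l" "v = col A b" using assms by (auto simp: cols_def)
    thus ?thesis using assms by auto
  qed
  have rows: "indep {..<l} T (\<lambda>i b. A $$ (i, b)) \<longleftrightarrow> indep S T (\<lambda>i v. v $ i)" if T: "T \<subseteq> {..<k}" for T
  proof -
    have "(\<forall>b\<in>{..<l}. (\<Sum>i\<in>T. c i * A $$ (i, b)) = 0) \<longleftrightarrow> (\<forall>v\<in>S. (\<Sum>i\<in>T. c i * v $ i) = 0)" for c
    proof
      assume L: "\<forall>b\<in>{..<l}. (\<Sum>i\<in>T. c i * A $$ (i, b)) = 0"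
      show "\<forall>v\<in>S. (\<Sum>i\<in>T. c i * v $ i) = 0"
      proof
        fix v assume "v \<in> S"
        then obtain b where b: "b < l" "\<forall>i<k. v $ i = A $$ (i, b)" using col_entry by blast
        hence "(\<Sum>i\<in>T. c i * v $ i) = (\<Sum>i\<in>T. c i * A $$ (i, b))" using T by (intro sum.cong) auto
        thus "(\<Sum>i\<in>T. c i * v $ i) = 0" using L b by simp
      qed
    next
      assume R: "\<forall>v\<in>S. (\<Sum>i\<in>T. c i * v $ i) = 0"
      show "\<forall>b\<in>{..<l}. (\<Sum>i\<in>T. c i * A $$ (i, b)) = 0"
      proof
        fix b assume "b \<in> {..<l}"
        hence "(\<Sum>i\<in>T. c i * A $$ (i, b)) = (\<Sum>i\<in>T. \<Sum>v\<in>S. c i * (a b v * v $ i))"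
          using T a by (intro sum.cong) (auto simp: sum_distrib_left)
        also have "\<dots> = (\<Sum>v\<in>S. \<Sum>i\<in>T. c i * (a b v * v $ i))" by (rule sum.swap)
        also have "\<dots> = (\<Sum>v\<in>S. a b v * (\<Sum>i\<in>T. c i * v $ i))" by (simp add: sum_distrib_left mult_ac)
        finally show "(\<Sum>i\<in>T. c i * A $$ (i, b)) = 0" using R by simp
      qed
    qed
    thus ?thesis unfolding indep_def by simp
  qed
  define P where "P = (\<lambda>T. T \<subseteq> {..<k} \<and> indep {..<l} T (\<lambda>i b. A $$ (i, b)))"
  have le: "card T \<le> card S" if "P T" for T
    using that rows finS indep_card_le[OF finS, of T] unfolding P_def by (meson finite_lessThan finite_subset)
  have "P {}" unfolding P_def indep_def by simp
  from ex_has_greatest_nat[of P, OF this, of card "card S + 1"]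
  obtain R where R: "P R" and Rmax: "\<And>T. P T \<Longrightarrow> card T \<le> card R" using le by (force simp: less_Suc_eq_le)
  have finR: "finite R" and Rk: "R \<subseteq> {..<k}" using R unfolding P_def using finite_subset by blast+
  have indR: "indep S R (\<lambda>i v. v $ i)" using R rows unfolding P_def by blast
  have row_span: "in_span S R (\<lambda>i v. v $ i) (\<lambda>v. v $ i)" if "i < k" for i
  proof (cases "i \<in> R")
    case True
    thus ?thesis using in_span_self[OF finR True, of S "\<lambda>i v. v $ i"] by simp
  next
    case False
    hence "\<not> P (insert i R)" using Rmax[of "insert i R"] finR by auto
    hence "\<not> indep S (insert i R) (\<lambda>i v. v $ i)" using that Rk rows[of "insert i R"] unfolding P_def by auto
    thus ?thesis using indep_insert_iff[OF finR False, of S "\<lambda>i v. v $ i"] indR by blast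
  qed
  have "card S \<le> card R"
  proof (rule indep_card_le[OF finR finS])
    show "indep R S (\<lambda>v i. v $ i)"
    proof (rule indepI)
      fix c v assume c: "\<And>i. i \<in> R \<Longrightarrow> (\<Sum>v\<in>S. c v * v $ i) = 0" and v: "v \<in> S"
      have "(\<Sum>v\<in>S. c v * v $ i) = 0" if i: "i \<in> {..<k}" for i
      proof -
        obtain d where d: "\<And>v. v \<in> S \<Longrightarrow> v $ i = (\<Sum>j\<in>R. d j * v $ j)"
          using row_span[of i] i unfolding in_span_def by auto
        hence "(\<Sum>v\<in>S. c v * v $ i) = (\<Sum>v\<in>S. \<Sum>j\<in>R. c v * (d j * v $ j))"
          by (intro sum.cong) (auto simp: sum_distrib_left)
        also have "\<dots> = (\<Sum>j\<in>R. \<Sum>v\<in>S. c v * (d j * v $ j))" by (rule sum.swap)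
        also have "\<dots> = (\<Sum>j\<in>R. d j * (\<Sum>v\<in>S. c v * v $ j))" by (simp add: sum_distrib_left mult_ac)
        finally show ?thesis using c by simp
      qed
      thus "c v = 0" using lin[OF Scols] Sind v indepD[of "{..<k}" S "\<lambda>v i. v $ i" c v] by blast
    qed
  qed
  hence "card R = card S" using le[OF R] by simp
  thus thesis using R Rmax unfolding P_def by (intro that[of R]) (auto simp: rank)
qed

text \<open>The set \<open>T\<close> is chosen of the largest size for which its rows are independent at some point.
  Wherever the rows in \<open>T\<close> are independent, which for polynomial entries is generically the case,
  they then span all rows in \<open>U\<close>.\<close>

lemma maximal_indep_exists:
  fixes f :: "real mat \<Rightarrow> 't \<Rightarrow> 'x \<Rightarrow> real"
  assumes "finite U"
  obtains T Y0 where "T \<subseteq> U" "Y0 \<in> carrier_mat m n" "indep X T (f Y0)"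
    "\<forall>T'\<subseteq>U. \<forall>Y\<in>carrier_mat m n. indep X T' (f Y) \<longrightarrow> card T' \<le> card T"
proof -
  define P where "P = (\<lambda>T. T \<subseteq> U \<and> (\<exists>Y\<in>carrier_mat m n. indep X T (f Y)))"
  have "P {}" unfolding P_def indep_def by (auto intro: exI[of _ "0\<^sub>m m n"])
  moreover have "\<forall>T. P T \<longrightarrow> card T < card U + 1"
    using assms unfolding P_def by (auto simp: less_Suc_eq_le intro: card_mono)
  ultimately obtain T where T: "P T" "\<And>T'. P T' \<Longrightarrow> card T' \<le> card T"
    using ex_has_greatest_nat[of P "{}" card "card U + 1"] by auto
  obtain Y0 where Y0: "T \<subseteq> U" "Y0 \<in> carrier_mat m n" "indep X T (f Y0)" using T unfolding P_def by blast
  show thesis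
  proof (rule that[OF Y0])
    show "\<forall>T'\<subseteq>U. \<forall>Y\<in>carrier_mat m n. indep X T' (f Y) \<longrightarrow> card T' \<le> card T"
      by (intro allI ballI impI T(2)) (auto simp: P_def)
  qed
qed

lemma generic_rank_generically:
  assumes A: "\<And>Y. Y \<in> carrier_mat m n \<Longrightarrow> A Y \<in> carrier_mat k l"
    and poly: "\<And>a b. a < k \<Longrightarrow> b < l \<Longrightarrow> (\<lambda>Y. A Y $$ (a, b)) \<in> poly_funs m n"
  shows "generically m n (\<lambda>Y. mat_rank (A Y) = generic_rank m n A)"
proof -
  obtain T Y0 where T: "T \<subseteq> {..<k}" "Y0 \<in> carrier_mat m n" "indep {..<l} T (\<lambda>a b. A Y0 $$ (a, b))"
    and max: "\<forall>T'\<subseteq>{..<k}. \<forall>Y\<in>carrier_mat m n. indep {..<l} T' (\<lambda>a b. A Y $$ (a, b)) \<longrightarrow> card T' \<le> card T"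
    by (rule maximal_indep_exists[of "{..<k}" m n "{..<l}" "\<lambda>Y a b. A Y $$ (a, b)", OF finite_lessThan])
  have "finite T" using T(1) finite_subset by blast
  then obtain p where p: "p \<in> poly_funs m n" "\<And>Y. p Y \<noteq> 0 \<longleftrightarrow> indep {..<l} T (\<lambda>a b. A Y $$ (a, b))"
    by (rule indep_polynomial[of T "{..<l}" "\<lambda>Y a b. A Y $$ (a, b)" m n]) (use T(1) poly in auto)
  have "mat_rank (A Y) = card T" if Y: "Y \<in> carrier_mat m n" "p Y \<noteq> 0" for Y
  proof -
    obtain R where R: "R \<subseteq> {..<k}" "card R = mat_rank (A Y)" "indep {..<l} R (\<lambda>a b. A Y $$ (a, b))"
      "\<forall>T\<subseteq>{..<k}. indep {..<l} T (\<lambda>a b. A Y $$ (a, b)) \<longrightarrow> card T \<le> mat_rank (A Y)"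
      using mat_rank_indep_rows[OF A[OF Y(1)]] by blast
    have "card T \<le> mat_rank (A Y)" using R(4) T(1) p(2) Y(2) by blast
    moreover have "card R \<le> card T" using max R(1,3) Y(1) by blast
    ultimately show ?thesis using R(2) by simp
  qed
  hence gen: "generically m n (\<lambda>Y. mat_rank (A Y) = card T)"
    using T p unfolding generically_def by blast
  have "r = card T" if "generically m n (\<lambda>Y. mat_rank (A Y) = r)" for r
    using almost_all_imp_ex[OF almost_all_conj[OF generically_imp_almost_all[OF gen] generically_imp_almost_all[OF that]]]
    by auto
  hence "generic_rank m n A = card T" unfolding generic_rank_def using gen by (intro the_equality)
  thus ?thesis using gen by simp
qed

section \<open>The likelihood of a coloured DAG\<close>

text \<open>The matrix \<open>\<Lambda>\<close> whose entry for an edge of colour \<open>t\<close> is \<open>lam t\<close>.\<close>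

definition Lambda_mat :: "nat \<Rightarrow> (nat \<times> nat) set \<Rightarrow> (nat \<times> nat \<Rightarrow> 'c) \<Rightarrow> ('c \<Rightarrow> real) \<Rightarrow> real mat" where
  "Lambda_mat m E ce lam = mat m m (\<lambda>(i, j). if (j, i) \<in> E then lam (ce (j, i)) else 0)"

text \<open>The diagonal matrix \<open>\<Omega>\<close> whose entry for a vertex of colour \<open>s\<close> is \<open>om s\<close>.\<close>

definition Omega_mat :: "nat \<Rightarrow> (nat \<Rightarrow> 'c) \<Rightarrow> ('c \<Rightarrow> real) \<Rightarrow> real mat" where
  "Omega_mat m cv om = mat m m (\<lambda>(i, j). if i = j then om (cv i) else 0)"

text \<open>The point of the model with parameters \<open>lam\<close> and \<open>om\<close>, indexed by colours. Values at colours
  that do not occur are immaterial, so that \<open>om\<close> may be assumed positive everywhere.\<close>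

definition Psi :: "nat \<Rightarrow> (nat \<times> nat) set \<Rightarrow> (nat \<Rightarrow> 'c) \<Rightarrow> (nat \<times> nat \<Rightarrow> 'c) \<Rightarrow>
    ('c \<Rightarrow> real) \<Rightarrow> ('c \<Rightarrow> real) \<Rightarrow> real mat" where
  "Psi m E cv ce lam om = transpose_mat (1\<^sub>m m - Lambda_mat m E ce lam) *
     the (mat_inverse (Omega_mat m cv om)) * (1\<^sub>m m - Lambda_mat m E ce lam)"

lemma rdag_model_eq:
  assumes "ordered_dag m E"
  shows "rdag_model m E cv ce = {Psi m E cv ce lam om | lam om. \<forall>s. om s > 0}"
proof -
  have E: "j < m" "i < m" if "(j, i) \<in> E" for i j
    using assms that unfolding ordered_dag_def by auto
  have L: "L \<in> rdag_Lambda m E ce \<longleftrightarrow> (\<exists>lam. L = Lambda_mat m E ce lam)" for L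
  proof
    assume L: "L \<in> rdag_Lambda m E ce"
    define lam where "lam t = (case SOME e. e \<in> E \<and> ce e = t of (j, i) \<Rightarrow> L $$ (i, j))" for t
    have Leq: "L $$ (i, j) = L $$ (k, l)" if "(j, i) \<in> E" "(l, k) \<in> E" "ce (j, i) = ce (l, k)" for i j k l
    proof -
      have "\<forall>(j, i)\<in>E. \<forall>(l, k)\<in>E. ce (j, i) = ce (l, k) \<longrightarrow> L $$ (i, j) = L $$ (k, l)"
        using L unfolding rdag_Lambda_def by blast
      from bspec[OF bspec[OF this that(1), unfolded case_prod_conv] that(2), unfolded case_prod_conv]
      show ?thesis using that(3) by (rule mp)
    qed
    have "lam (ce (j, i)) = L $$ (i, j)" if ji: "(j, i) \<in> E" for i j
    proof -
      have "\<exists>e. e \<in> E \<and> ce e = ce (j, i)" using ji by blast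
      from someI_ex[OF this] obtain k l
        where "(SOME e. e \<in> E \<and> ce e = ce (j, i)) = (l, k)" "(l, k) \<in> E" "ce (l, k) = ce (j, i)"
        by (cases "SOME e. e \<in> E \<and> ce e = ce (j, i)") auto
      thus ?thesis unfolding lam_def using Leq[OF _ ji] by simp
    qed
    hence "L = Lambda_mat m E ce lam"
      using L unfolding rdag_Lambda_def Lambda_mat_def by (intro eq_matI) auto
    thus "\<exists>lam. L = Lambda_mat m E ce lam" by blast
  next
    assume "\<exists>lam. L = Lambda_mat m E ce lam"
    then obtain lam where L: "L = Lambda_mat m E ce lam" ..
    have "L $$ (i, j) = lam (ce (j, i))" if "(j, i) \<in> E" for i j
      using that E[OF that] by (simp add: L Lambda_mat_def)
    moreover have "L $$ (i, j) = 0" if "(j, i) \<notin> E" "i < m" "j < m" for i j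
      using that by (simp add: L Lambda_mat_def)
    moreover have "L \<in> carrier_mat m m" by (simp add: L Lambda_mat_def)
    ultimately show "L \<in> rdag_Lambda m E ce" unfolding rdag_Lambda_def by auto
  qed
  have W: "W \<in> rdag_Omega m cv \<longleftrightarrow> (\<exists>om. (\<forall>s. om s > 0) \<and> W = Omega_mat m cv om)" for W
  proof
    assume W: "W \<in> rdag_Omega m cv"
    define om where "om s = (if \<exists>i<m. cv i = s then W $$ (SOME i. i < m \<and> cv i = s, SOME i. i < m \<and> cv i = s) else 1)" for s
    have "om (cv i) = W $$ (i, i)" if i: "i < m" for i
    proof -
      have ex: "\<exists>k. k < m \<and> cv k = cv i" using i by blast
      from someI_ex[OF this] have "W $$ (SOME k. k < m \<and> cv k = cv i, SOME k. k < m \<and> cv k = cv i) = W $$ (i, i)"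
        using W i unfolding rdag_Omega_def by blast
      thus ?thesis unfolding om_def using ex by (simp only: if_True)
    qed
    moreover have "W \<in> carrier_mat m m" "diagonal_mat W" using W unfolding rdag_Omega_def by blast+
    ultimately have "W = Omega_mat m cv om"
      unfolding Omega_mat_def by (intro eq_matI) (auto simp: diagonal_mat_def)
    moreover have "om s > 0" for s
    proof (cases "\<exists>i<m. cv i = s")
      case True
      from someI_ex[OF this] have "W $$ (SOME i. i < m \<and> cv i = s, SOME i. i < m \<and> cv i = s) > 0"
        using W unfolding rdag_Omega_def by blast
      thus ?thesis unfolding om_def using True by (simp only: if_True)
    next
      case False
      thus ?thesis unfolding om_def by (simp only: if_False zero_less_one)
    qed
    ultimately show "\<exists>om. (\<forall>s. om s > 0) \<and> W = Omega_mat m cv om" by blast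
  next
    assume "\<exists>om. (\<forall>s. om s > 0) \<and> W = Omega_mat m cv om"
    thus "W \<in> rdag_Omega m cv" unfolding rdag_Omega_def Omega_mat_def by (auto simp: diagonal_mat_def)
  qed
  show ?thesis unfolding rdag_model_def Psi_def L W by blast
qed

lemma mat_inverse_Omega_mat:
  assumes "\<And>s. om s > 0"
  shows "the (mat_inverse (Omega_mat m cv om)) = Omega_mat m cv (\<lambda>s. 1 / om s)"
proof -
  let ?W = "Omega_mat m cv om" and ?V = "Omega_mat m cv (\<lambda>s. 1 / om s)"
  have carr: "?W \<in> carrier_mat m m" "?V \<in> carrier_mat m m" unfolding Omega_mat_def by auto
  have nz: "om s \<noteq> 0" for s using assms[of s] by simp
  have diag: "(\<Sum>k = 0..<m. (if i = k then a else 0) * (if k = j then b k else 0)) =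
      (if i = j then a * b i else (0::real))" if "i < m" for i j a and b :: "nat \<Rightarrow> real"
    using that by (subst sum.remove[of _ i]) (auto simp: sum.neutral)
  have prods: "?W * ?V = 1\<^sub>m m" "?V * ?W = 1\<^sub>m m"
    using nz by (auto intro!: eq_matI simp: Omega_mat_def scalar_prod_def diag)
  hence "?W \<in> Units (ring_mat TYPE(real) m ())"
    using carr unfolding Units_def ring_mat_def by auto
  then obtain V where Some: "mat_inverse ?W = Some V"
    using mat_inverse(1)[OF carr(1), of "()"] by (cases "mat_inverse ?W") auto
  from mat_inverse(2)[OF carr(1) this] have V: "V * ?W = 1\<^sub>m m" "V \<in> carrier_mat m m" by auto
  hence "V = V * (?W * ?V)" unfolding prods by simp
  also have "\<dots> = V * ?W * ?V" using V(2) carr by (simp add: assoc_mult_mat[of V m m _ m _ m])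
  also have "\<dots> = ?V" unfolding V(1) using carr by simp
  finally show ?thesis using Some by simp
qed

lemma Psi_carrier [simp]:
  assumes "\<And>s. om s > 0"
  shows "Psi m E cv ce lam om \<in> carrier_mat m m"
  unfolding Psi_def mat_inverse_Omega_mat[OF assms] by (auto simp: Omega_mat_def Lambda_mat_def)

lemma Psi_entry:
  assumes "\<And>s. om s > 0" "a < m" "b < m"
  shows "Psi m E cv ce lam om $$ (a, b) = (\<Sum>i<m. (1\<^sub>m m - Lambda_mat m E ce lam) $$ (i, a) *
     (1\<^sub>m m - Lambda_mat m E ce lam) $$ (i, b) / om (cv i))"
proof -
  define B where "B = 1\<^sub>m m - Lambda_mat m E ce lam"
  define V where "V = Omega_mat m cv (\<lambda>s. 1 / om s)"
  have B: "B \<in> carrier_mat m m" unfolding B_def Lambda_mat_def by auto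
  have V: "V \<in> carrier_mat m m" "\<And>i j. i < m \<Longrightarrow> j < m \<Longrightarrow> V $$ (i, j) = (if i = j then 1 / om (cv i) else 0)"
    unfolding V_def Omega_mat_def by auto
  have 1: "(transpose_mat B * V) $$ (a, i) = B $$ (i, a) / om (cv i)" if i: "i < m" for i
  proof -
    have "(transpose_mat B * V) $$ (a, i) = (\<Sum>k = 0..<m. B $$ (k, a) * V $$ (k, i))"
      using B V(1) assms(2) i by (simp add: scalar_prod_def)
    also have "\<dots> = B $$ (i, a) * V $$ (i, i) + (\<Sum>k \<in> {0..<m} - {i}. B $$ (k, a) * V $$ (k, i))"
      using i by (subst sum.remove[of _ i]) auto
    also have "(\<Sum>k \<in> {0..<m} - {i}. B $$ (k, a) * V $$ (k, i)) = 0"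
      using i V(2) by (intro sum.neutral) auto
    finally show ?thesis using V(2) i by simp
  qed
  define M where "M = transpose_mat B * V"
  have "M \<in> carrier_mat m m" using B V(1) unfolding M_def by simp
  hence "(M * B) $$ (a, b) = (\<Sum>i = 0..<m. M $$ (a, i) * B $$ (i, b))"
    using B assms(2,3) by (simp add: scalar_prod_def)
  also have "\<dots> = (\<Sum>i<m. B $$ (i, a) * B $$ (i, b) / om (cv i))"
    unfolding lessThan_atLeast0 by (intro sum.cong) (auto simp: 1 M_def)
  finally show ?thesis
    unfolding Psi_def mat_inverse_Omega_mat[OF assms(1)] M_def B_def V_def .
qed

lemma det_Psi:
  assumes "ordered_dag m E" "\<And>s. om s > 0"
  shows "det (Psi m E cv ce lam om) = (\<Prod>i<m. 1 / om (cv i))"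
proof -
  define B where "B = 1\<^sub>m m - Lambda_mat m E ce lam"
  define V where "V = Omega_mat m cv (\<lambda>s. 1 / om s)"
  have B: "B \<in> carrier_mat m m" and V: "V \<in> carrier_mat m m"
    unfolding B_def Lambda_mat_def V_def Omega_mat_def by auto
  have E: "i < j" if "(j, i) \<in> E" for i j using assms(1) that unfolding ordered_dag_def by auto
  have "upper_triangular B" using E B unfolding B_def Lambda_mat_def by (force simp: upper_triangular_def)
  hence "det B = (\<Prod>i = 0..<m. B $$ (i, i))"
    using B by (subst det_upper_triangular[of _ m]) (auto simp: prod_list_diag_prod)
  also have "\<dots> = 1" using E by (intro prod.neutral) (force simp: B_def Lambda_mat_def)
  finally have detB: "det B = 1" .
  have "upper_triangular V" unfolding V_def Omega_mat_def by (auto simp: upper_triangular_def)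
  hence "det V = (\<Prod>i = 0..<m. V $$ (i, i))"
    using V by (subst det_upper_triangular[of _ m]) (auto simp: prod_list_diag_prod)
  also have "\<dots> = (\<Prod>i<m. 1 / om (cv i))"
    unfolding lessThan_atLeast0 by (intro prod.cong) (auto simp: V_def Omega_mat_def)
  finally have "det (transpose_mat B * V * B) = (\<Prod>i<m. 1 / om (cv i))"
    using B V detB by (simp add: det_mult[of _ m] det_transpose[of _ m])
  thus ?thesis
    unfolding Psi_def mat_inverse_Omega_mat[OF assms(2)] B_def[symmetric] V_def[symmetric] .
qed

text \<open>The \<open>(i, b)\<close> entry of the row of \<open>M'\<close> belonging to the edge colour \<open>t\<close>: the sum of the
  \<open>b\<close>-th samples at the parents of \<open>i\<close> along edges of colour \<open>t\<close>. Indexing the columns of \<open>M'\<close>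
  by pairs of a vertex and a sample, and its rows by colours, avoids the enumerations in
  \<open>M_prime\<close>.\<close>

definition parent_sum :: "(nat \<times> nat) set \<Rightarrow> (nat \<times> nat \<Rightarrow> 'c) \<Rightarrow> real mat \<Rightarrow> 'c \<Rightarrow> nat \<times> nat \<Rightarrow> real" where
  "parent_sum E ce Y t x = (\<Sum>j | (j, fst x) \<in> E \<and> ce (j, fst x) = t. Y $$ (j, snd x))"

text \<open>The column indices of \<open>M'\<close> for the vertex colour \<open>s\<close> and \<open>n\<close> samples, which are also the
  positions in \<open>Y\<close> of the samples at the vertices of colour \<open>s\<close>.\<close>

definition cells :: "nat \<Rightarrow> (nat \<Rightarrow> 'c) \<Rightarrow> nat \<Rightarrow> 'c \<Rightarrow> (nat \<times> nat) set" where
  "cells m cv n s = vertices_of m cv s \<times> {..<n}"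

text \<open>The residual sum of squares when the samples at the vertices of colour \<open>s\<close> are predicted from
  their parents with the coefficients \<open>lam\<close>.\<close>

definition rss :: "nat \<Rightarrow> (nat \<times> nat) set \<Rightarrow> (nat \<Rightarrow> 'c) \<Rightarrow> (nat \<times> nat \<Rightarrow> 'c) \<Rightarrow> real mat \<Rightarrow> 'c \<Rightarrow> ('c \<Rightarrow> real) \<Rightarrow> real" where
  "rss m E cv ce Y s lam = (\<Sum>x\<in>cells m cv (dim_col Y) s.
     (Y $$ x - (\<Sum>t\<in>prc E cv ce s. lam t * parent_sum E ce Y t x))\<^sup>2)"

text \<open>The contribution of the vertex colour \<open>s\<close>, with variance \<open>w\<close>, to minus the log-likelihood.\<close>

definition cost :: "nat \<Rightarrow> (nat \<times> nat) set \<Rightarrow> (nat \<Rightarrow> 'c) \<Rightarrow> (nat \<times> nat \<Rightarrow> 'c) \<Rightarrow> real mat \<Rightarrow> 'c \<Rightarrow> ('c \<Rightarrow> real) \<Rightarrow> real \<Rightarrow> real" where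
  "cost m E cv ce Y s lam w = real (alpha m cv s) * ln w + rss m E cv ce Y s lam / (real (dim_col Y) * w)"

lemma finite_dag: "ordered_dag m E \<Longrightarrow> finite E"
  unfolding ordered_dag_def using finite_subset by blast

lemma finite_prc:
  assumes "ordered_dag m E" shows "finite (prc E cv ce s)"
proof -
  have "prc E cv ce s \<subseteq> ce ` E" unfolding prc_def by auto
  thus ?thesis using finite_dag[OF assms] finite_subset by blast
qed

lemma finite_vertices_of [simp]: "finite (vertices_of m cv s)"
  unfolding vertices_of_def by simp

lemma finite_cells [simp]: "finite (cells m cv n s)"
  unfolding cells_def by simp

lemma card_cells: "card (cells m cv n s) = alpha m cv s * n"
  unfolding cells_def alpha_def by (simp add: card_cartesian_product)

text \<open>The left-hand side is the \<open>(i, b)\<close> entry of \<open>(id - \<Lambda>) Y\<close>.\<close>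

lemma residual_eq:
  assumes "ordered_dag m E" "Y \<in> carrier_mat m n" "i < m" "b < n"
  shows "(\<Sum>j<m. (1\<^sub>m m - Lambda_mat m E ce lam) $$ (i, j) * Y $$ (j, b)) =
    Y $$ (i, b) - (\<Sum>t\<in>prc E cv ce (cv i). lam t * parent_sum E ce Y t (i, b))"
proof -
  have E: "j < m" if "(j, i) \<in> E" for i j
    using assms(1) that unfolding ordered_dag_def by auto
  let ?P = "{j. (j, i) \<in> E}"
  have fin: "finite ?P" using E by (intro finite_subset[of ?P "{..<m}"]) auto
  have "(\<Sum>j<m. (1\<^sub>m m - Lambda_mat m E ce lam) $$ (i, j) * Y $$ (j, b)) =
     (\<Sum>j<m. (if i = j then 1 else 0) * Y $$ (j, b)) - (\<Sum>j<m. (if (j, i) \<in> E then lam (ce (j, i)) else 0) * Y $$ (j, b))"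
    unfolding sum_subtractf[symmetric] using assms by (intro sum.cong) (auto simp: Lambda_mat_def left_diff_distrib)
  also have "(\<Sum>j<m. (if i = j then 1 else 0) * Y $$ (j, b)) = Y $$ (i, b)"
    using assms(3) by (subst sum.remove[of _ i]) (auto simp: sum.neutral)
  also have "(\<Sum>j<m. (if (j, i) \<in> E then lam (ce (j, i)) else 0) * Y $$ (j, b)) =
     (\<Sum>j\<in>?P. lam (ce (j, i)) * Y $$ (j, b))"
    using E by (intro sum.mono_neutral_cong_right) auto
  also have "\<dots> = (\<Sum>t\<in>prc E cv ce (cv i). \<Sum>j | j \<in> ?P \<and> ce (j, i) = t. lam (ce (j, i)) * Y $$ (j, b))"
    using fin finite_prc[OF assms(1)] by (subst sum.group) (auto simp: prc_def)
  also have "\<dots> = (\<Sum>t\<in>prc E cv ce (cv i). lam t * parent_sum E ce Y t (i, b))"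
    unfolding parent_sum_def by (intro sum.cong refl) (auto simp: sum_distrib_left intro!: sum.cong)
  finally show ?thesis .
qed

lemma sum_swap4:
  "(\<Sum>a\<in>A. \<Sum>b\<in>B. \<Sum>c\<in>C. \<Sum>d\<in>D. f a b c d) = (\<Sum>c\<in>C. \<Sum>d\<in>D. \<Sum>a\<in>A. \<Sum>b\<in>B. f a b c d)"
proof -
  have "(\<Sum>a\<in>A. \<Sum>b\<in>B. \<Sum>c\<in>C. \<Sum>d\<in>D. f a b c d) = (\<Sum>a\<in>A. \<Sum>c\<in>C. \<Sum>b\<in>B. \<Sum>d\<in>D. f a b c d)"
    by (intro sum.cong refl sum.swap)
  also have "\<dots> = (\<Sum>c\<in>C. \<Sum>a\<in>A. \<Sum>b\<in>B. \<Sum>d\<in>D. f a b c d)" by (rule sum.swap)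
  also have "\<dots> = (\<Sum>c\<in>C. \<Sum>a\<in>A. \<Sum>d\<in>D. \<Sum>b\<in>B. f a b c d)" by (intro sum.cong refl sum.swap)
  also have "\<dots> = (\<Sum>c\<in>C. \<Sum>d\<in>D. \<Sum>a\<in>A. \<Sum>b\<in>B. f a b c d)" by (rule sum.cong[OF refl sum.swap])
  finally show ?thesis .
qed

text \<open>With \<open>P = B\<^sup>T V B\<close> and \<open>V\<close> diagonal, the trace is the sum of the squared entries of \<open>B Y\<close> with
  weights \<open>v\<close>, divided by \<open>n\<close>.\<close>

lemma trace_quadratic:
  fixes P Y :: "real mat"
  assumes P: "P \<in> carrier_mat m m" and Y: "Y \<in> carrier_mat m n"
    and entry: "\<And>a b. a < m \<Longrightarrow> b < m \<Longrightarrow> P $$ (a, b) = (\<Sum>i<m. B i a * B i b * v i)"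
  shows "mat_trace (P * sample_cov Y) = (\<Sum>i<m. v i * (\<Sum>k<n. (\<Sum>j<m. B i j * Y $$ (j, k))\<^sup>2)) / real n"
proof -
  have S: "sample_cov Y $$ (b, a) = (\<Sum>k<n. Y $$ (b, k) * Y $$ (a, k)) / real n" if "a < m" "b < m" for a b
    using Y that by (simp add: sample_cov_def scalar_prod_def lessThan_atLeast0)
  have carr: "sample_cov Y \<in> carrier_mat m m" using Y unfolding sample_cov_def by auto
  have "mat_trace (P * sample_cov Y) = (\<Sum>a<m. \<Sum>b<m. P $$ (a, b) * sample_cov Y $$ (b, a))"
    unfolding mat_trace_def using P carr by (simp add: scalar_prod_def lessThan_atLeast0)
  also have "\<dots> = (\<Sum>a<m. \<Sum>b<m. \<Sum>i<m. \<Sum>k<n. v i * (B i a * Y $$ (a, k)) * (B i b * Y $$ (b, k)) / real n)"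
    by (intro sum.cong refl) (simp add: entry S sum_product sum_divide_distrib mult_ac)
  also have "\<dots> = (\<Sum>i<m. \<Sum>k<n. \<Sum>a<m. \<Sum>b<m. v i * (B i a * Y $$ (a, k)) * (B i b * Y $$ (b, k)) / real n)"
    by (rule sum_swap4)
  also have "\<dots> = (\<Sum>i<m. v i * (\<Sum>k<n. (\<Sum>j<m. B i j * Y $$ (j, k))\<^sup>2)) / real n"
    by (simp add: power2_eq_square sum_product) (simp add: sum_distrib_left sum_divide_distrib mult.assoc)
  finally show ?thesis .
qed

lemma log_lik_Psi:
  assumes dag: "ordered_dag m E" and om: "\<And>s. om s > 0" and Y: "Y \<in> carrier_mat m n"
  shows "log_lik Y (Psi m E cv ce lam om) = - (\<Sum>s\<in>cv ` {..<m}. cost m E cv ce Y s lam (om s))"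
proof -
  define B where "B i j = (1\<^sub>m m - Lambda_mat m E ce lam) $$ (i, j)" for i j
  define r where "r x = (Y $$ x - (\<Sum>t\<in>prc E cv ce (cv (fst x)). lam t * parent_sum E ce Y t x))\<^sup>2" for x
  have grp: "(\<Sum>s\<in>cv ` {..<m}. \<Sum>i\<in>vertices_of m cv s. g i) = (\<Sum>i<m. g i)" for g :: "nat \<Rightarrow> real"
    unfolding vertices_of_def by (intro sum.group) auto
  have rss: "rss m E cv ce Y s lam = (\<Sum>i\<in>vertices_of m cv s. \<Sum>b<n. r (i, b))" for s
    using Y unfolding rss_def cells_def r_def
    by (auto simp: sum.cartesian_product vertices_of_def intro!: sum.cong)
  have det: "ln (det (Psi m E cv ce lam om)) = - (\<Sum>i<m. ln (om (cv i)))"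
  proof -
    have pos: "om s \<noteq> 0" "ln (1 / om s) = - ln (om s)" for s using om[of s] by (auto simp: ln_div)
    have "ln (\<Prod>i<m. 1 / om (cv i)) = (\<Sum>i<m. ln (1 / om (cv i)))"
      using om pos by (intro ln_prod) auto
    thus ?thesis unfolding det_Psi[OF dag om] pos by (simp add: sum_negf)
  qed
  have logs: "(\<Sum>i<m. ln (om (cv i))) = (\<Sum>s\<in>cv ` {..<m}. real (alpha m cv s) * ln (om s))"
    unfolding grp[symmetric] by (intro sum.cong) (auto simp: alpha_def vertices_of_def)
  have "mat_trace (Psi m E cv ce lam om * sample_cov Y) =
      (\<Sum>i<m. 1 / om (cv i) * (\<Sum>b<n. (\<Sum>j<m. B i j * Y $$ (j, b))\<^sup>2)) / real n"
    using om Y by (intro trace_quadratic) (auto simp: Psi_entry B_def)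
  also have "(\<Sum>i<m. 1 / om (cv i) * (\<Sum>b<n. (\<Sum>j<m. B i j * Y $$ (j, b))\<^sup>2)) =
      (\<Sum>i<m. 1 / om (cv i) * (\<Sum>b<n. r (i, b)))"
    unfolding B_def r_def by (intro sum.cong refl arg_cong2[where f = "(*)"]) (simp add: residual_eq[OF dag Y, where cv = cv])
  also have "\<dots> = (\<Sum>s\<in>cv ` {..<m}. rss m E cv ce Y s lam / om s)"
    unfolding grp[symmetric] rss by (intro sum.cong refl) (auto simp: vertices_of_def sum_divide_distrib intro!: sum.cong)
  finally show ?thesis
    using Y unfolding log_lik_def cost_def det logs by (simp add: sum.distrib sum_divide_distrib mult.commute)
qed

text \<open>If \<open>i\<close> is the first row in which two matrices \<open>\<Lambda>\<close> differ, say in column \<open>j\<close>, then the \<open>(i, j)\<close>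
  entries of the two matrices \<open>Psi\<close> differ, because in column \<open>i\<close> of \<open>id - \<Lambda>\<close> only rows up to \<open>i\<close>
  are nonzero.\<close>

lemma Psi_inj_Lambda:
  assumes dag: "ordered_dag m E" and om: "\<And>s. om s > 0"
    and eq: "Psi m E cv ce lam om = Psi m E cv ce lam' om" and e: "(j, i) \<in> E"
  shows "lam (ce (j, i)) = lam' (ce (j, i))"
proof -
  have E: "j < m" "i < m" "i < j" if "(j, i) \<in> E" for i j
    using dag that unfolding ordered_dag_def by auto
  let ?B = "\<lambda>lam k j. (1\<^sub>m m - Lambda_mat m E ce lam) $$ (k, j)"
  have B: "?B lam k j = (if k = j then 1 else 0) - (if (j, k) \<in> E then lam (ce (j, k)) else 0)"
    if "k < m" "j < m" for k j lam
    using that by (simp add: Lambda_mat_def)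
  show ?thesis using e
  proof (induction i arbitrary: j rule: less_induct)
    case (less i)
    have "(\<Sum>k<m. ?B lam k i * ?B lam k j / om (cv k)) = (\<Sum>k<m. ?B lam' k i * ?B lam' k j / om (cv k))"
      using Psi_entry[where om = om, OF om E(2)[OF less.prems] E(1)[OF less.prems], of E cv ce lam]
        Psi_entry[where om = om, OF om E(2)[OF less.prems] E(1)[OF less.prems], of E cv ce lam'] eq by simp
    moreover have "(\<Sum>k<m. ?B l k i * ?B l k j / om (cv k)) =
       - l (ce (j, i)) / om (cv i) + (\<Sum>k<i. ?B l k i * ?B l k j / om (cv k))" for l
    proof -
      have "(\<Sum>k<m. ?B l k i * ?B l k j / om (cv k)) = (\<Sum>k<Suc i. ?B l k i * ?B l k j / om (cv k))"
      proof (rule sum.mono_neutral_right)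
        show "\<forall>k\<in>{..<m} - {..<Suc i}. ?B l k i * ?B l k j / om (cv k) = 0"
        proof
          fix k assume k: "k \<in> {..<m} - {..<Suc i}"
          hence "(i, k) \<notin> E" using E(3)[of i k] by auto
          hence "?B l k i = 0" using B[of k i l] k by auto
          thus "?B l k i * ?B l k j / om (cv k) = 0" by simp
        qed
      qed (use E[OF less.prems] in auto)
      moreover have "?B l i i = 1" "?B l i j = - l (ce (j, i))"
        using E[OF less.prems] B less.prems E(3)[of i i] by auto
      ultimately show ?thesis by simp
    qed
    moreover have "(\<Sum>k<i. ?B lam k i * ?B lam k j / om (cv k)) = (\<Sum>k<i. ?B lam' k i * ?B lam' k j / om (cv k))"
    proof (rule sum.cong)
      fix k assume "k \<in> {..<i}"
      hence k: "k < i" "k < m" using E[OF less.prems] by auto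
      have "?B lam k l = ?B lam' k l" if "l < m" for l
        using B[OF k(2) that] less.IH[OF k(1), of l] by auto
      thus "?B lam k i * ?B lam k j / om (cv k) = ?B lam' k i * ?B lam' k j / om (cv k)"
        using E[OF less.prems] by simp
    qed simp
    ultimately have "lam (ce (j, i)) / om (cv i) = lam' (ce (j, i)) / om (cv i)" by simp
    thus ?case using om[of "cv i"] by simp
  qed
qed

section \<open>Existence and uniqueness of the maximum likelihood estimate\<close>

lemma rss_nonneg: "rss m E cv ce Y s lam \<ge> 0"
  unfolding rss_def by (intro sum_nonneg) auto

lemma rss_cong:
  assumes "\<And>t. t \<in> prc E cv ce s \<Longrightarrow> lam t = lam' t"
  shows "rss m E cv ce Y s lam = rss m E cv ce Y s lam'"
  unfolding rss_def using assms by (intro sum.cong refl arg_cong2[where f = "power"] arg_cong2[where f = "(-)"]) auto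

lemma rss_eq_0_iff:
  "rss m E cv ce Y s lam = 0 \<longleftrightarrow>
     (\<forall>x\<in>cells m cv (dim_col Y) s. Y $$ x = (\<Sum>t\<in>prc E cv ce s. lam t * parent_sum E ce Y t x))"
  unfolding rss_def by (subst sum_nonneg_eq_0_iff) auto

text \<open>This is \<open>ln z \<le> z - 1\<close>, with equality only at \<open>z = 1\<close>, for \<open>z = D / (k * w)\<close>.\<close>

lemma log_div_minimum:
  fixes k D w :: real
  assumes "k > 0" "D > 0" "w > 0"
  shows "k * ln (D / k) + k \<le> k * ln w + D / w"
    and "k * ln w + D / w = k * ln (D / k) + k \<Longrightarrow> w = D / k"
proof -
  define z where "z = D / (k * w)"
  have z: "z > 0" using assms unfolding z_def by simp
  have lnz: "ln z = ln (D / k) - ln w" using assms unfolding z_def by (simp add: ln_div ln_mult)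
  have kz: "k * z = D / w" using assms unfolding z_def by simp
  have "k * ln z \<le> k * (z - 1)" using ln_le_minus_one[OF z] assms by (intro mult_left_mono) auto
  thus "k * ln (D / k) + k \<le> k * ln w + D / w"
    using kz unfolding lnz by (simp add: algebra_simps)
  assume "k * ln w + D / w = k * ln (D / k) + k"
  hence "k * ln z = k * (z - 1)" using kz unfolding lnz by (simp add: algebra_simps)
  hence "ln z = z - 1" using assms by simp
  hence "z = 1" using ln_eq_minus_one z by blast
  thus "w = D / k" using assms unfolding z_def by (simp add: field_simps)
qed

lemma alpha_pos: "s \<in> cv ` {..<m} \<Longrightarrow> alpha m cv s > 0"
  unfolding alpha_def by (auto simp: card_gt_0_iff vertices_of_def)

lemma cost_minimiser:
  assumes dag: "ordered_dag m E" and s: "s \<in> cv ` {..<m}" and n: "dim_col Y > 0"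
    and nspan: "\<not> in_span (cells m cv (dim_col Y) s) (prc E cv ce s) (parent_sum E ce Y) (\<lambda>x. Y $$ x)"
  obtains c w0 where "w0 > 0"
    "\<And>lam w. w > 0 \<Longrightarrow> cost m E cv ce Y s c w0 \<le> cost m E cv ce Y s lam w"
    "\<And>lam w t. indep (cells m cv (dim_col Y) s) (prc E cv ce s) (parent_sum E ce Y) \<Longrightarrow>
       w > 0 \<Longrightarrow> cost m E cv ce Y s lam w = cost m E cv ce Y s c w0 \<Longrightarrow>
       w = w0 \<and> (\<forall>t\<in>prc E cv ce s. lam t = c t)"
proof -
  let ?X = "cells m cv (dim_col Y) s" and ?T = "prc E cv ce s" and ?f = "parent_sum E ce Y"
  let ?rss = "rss m E cv ce Y s"
  have "\<exists>c. \<forall>lam. ?rss lam = ?rss c + (\<Sum>x\<in>?X. (\<Sum>t\<in>?T. (lam t - c t) * ?f t x)\<^sup>2)"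
    unfolding rss_def
    by (rule least_squares_exists[of ?T ?X "\<lambda>x. Y $$ x" ?f, OF finite_prc[OF dag] finite_cells])
  then obtain c where "\<forall>lam. ?rss lam = ?rss c + (\<Sum>x\<in>?X. (\<Sum>t\<in>?T. (lam t - c t) * ?f t x)\<^sup>2)" ..
  hence c: "?rss lam = ?rss c + (\<Sum>x\<in>?X. (\<Sum>t\<in>?T. (lam t - c t) * ?f t x)\<^sup>2)" for lam by (rule spec)
  have "?rss c \<noteq> 0" using nspan unfolding rss_eq_0_iff in_span_def by blast
  hence rc: "?rss c > 0" using rss_nonneg[of m E cv ce Y s c] by simp
  define k where "k = real (alpha m cv s)"
  define D where "D lam = ?rss lam / real (dim_col Y)" for lam
  have k: "k > 0" using alpha_pos[OF s] unfolding k_def by simp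
  have D: "D c > 0" "D c \<le> D lam" for lam
    using rc n c[of lam] by (auto simp: D_def intro!: divide_right_mono sum_nonneg)
  have cost: "cost m E cv ce Y s lam w = k * ln w + D lam / w" for lam w
    unfolding cost_def k_def D_def by simp
  define w0 where "w0 = D c / k"
  have w0: "w0 > 0" using D(1) k unfolding w0_def by simp
  have cost0: "cost m E cv ce Y s c w0 = k * ln (D c / k) + k"
    unfolding cost using D(1) k by (simp add: w0_def)
  have le: "k * ln w + D c / w \<le> cost m E cv ce Y s lam w" if "w > 0" for lam w
    unfolding cost using D(2)[of lam] that by (simp add: divide_right_mono)
  show thesis
  proof (rule that[of w0 c])
    show "w0 > 0" by fact
    show "cost m E cv ce Y s c w0 \<le> cost m E cv ce Y s lam w" if "w > 0" for lam w
      using log_div_minimum(1)[OF k D(1) that] le[OF that, of lam] unfolding cost0 by linarith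
    show "w = w0 \<and> (\<forall>t\<in>?T. lam t = c t)"
      if ind: "indep ?X ?T ?f" and w: "w > 0" and eq: "cost m E cv ce Y s lam w = cost m E cv ce Y s c w0" for lam w
    proof
      have "k * ln w + D c / w = k * ln (D c / k) + k"
        using log_div_minimum(1)[OF k D(1) w] le[OF w, of lam] eq unfolding cost0 by linarith
      thus "w = w0" using log_div_minimum(2)[OF k D(1) w] unfolding w0_def by blast
      hence "D lam = D c" using eq w unfolding cost by simp
      hence "?rss lam = ?rss c" using n unfolding D_def by simp
      hence "(\<Sum>x\<in>?X. (\<Sum>t\<in>?T. (lam t - c t) * ?f t x)\<^sup>2) = 0" using c[of lam] by simp
      hence "\<forall>x\<in>?X. (\<Sum>t\<in>?T. (lam t - c t) * ?f t x)\<^sup>2 = 0"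
        using sum_nonneg_eq_0_iff[OF finite_cells, of m cv "dim_col Y" s "\<lambda>x. (\<Sum>t\<in>?T. (lam t - c t) * ?f t x)\<^sup>2"]
        by simp
      hence zero: "(\<Sum>t\<in>?T. (lam t - c t) * ?f t x) = 0" if "x \<in> ?X" for x using that by simp
      have "lam t - c t = 0" if "t \<in> ?T" for t
        by (rule indepD[OF ind, of "\<lambda>t. lam t - c t"]) (use zero that in auto)
      thus "\<forall>t\<in>?T. lam t = c t" by simp
    qed
  qed
qed

lemma prc_disjoint:
  assumes "compatible m E cv ce" "t \<in> prc E cv ce s" "t \<in> prc E cv ce s'"
  shows "s = s'"
  using assms unfolding compatible_def prc_def by blast

text \<open>Compatibility allows the coefficients of the different vertex colours to be chosen
  independently.\<close>

lemma combine_colours: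
  assumes "compatible m E cv ce"
  obtains lam where "\<And>s t. t \<in> prc E cv ce s \<Longrightarrow> lam t = (c s t :: real)"
proof
  fix s t assume "t \<in> prc E cv ce s"
  thus "c (THE s. t \<in> prc E cv ce s) t = c s t"
    using prc_disjoint[OF assms] by (metis the_equality)
qed

lemma Psi_cong:
  assumes "ordered_dag m E" "\<And>s. om s > 0" "\<And>s. om' s > 0"
    and "\<And>s t. s \<in> cv ` {..<m} \<Longrightarrow> t \<in> prc E cv ce s \<Longrightarrow> lam t = lam' t"
    and "\<And>s. s \<in> cv ` {..<m} \<Longrightarrow> om s = om' s"
  shows "Psi m E cv ce lam om = Psi m E cv ce lam' om'"
proof -
  have "Lambda_mat m E ce lam = Lambda_mat m E ce lam'"
  proof -
    have "lam (ce (j, i)) = lam' (ce (j, i))" if "(j, i) \<in> E" "i < m" for i j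
    proof (rule assms(4)[of "cv i"])
      show "ce (j, i) \<in> prc E cv ce (cv i)" using that(1) unfolding prc_def by blast
    qed (use that in simp)
    thus ?thesis unfolding Lambda_mat_def by (intro cong_mat) auto
  qed
  moreover have "Omega_mat m cv om = Omega_mat m cv om'"
    unfolding Omega_mat_def by (intro cong_mat) (auto intro!: assms(5))
  ultimately show ?thesis unfolding Psi_def by simp
qed

lemma is_mle_iff:
  assumes dag: "ordered_dag m E" and Y: "Y \<in> carrier_mat m n"
  shows "is_mle (rdag_model m E cv ce) Y P \<longleftrightarrow> (\<exists>lam om. (\<forall>s. om s > 0) \<and> P = Psi m E cv ce lam om \<and>
     (\<forall>lam' om'. (\<forall>s. om' s > 0) \<longrightarrow>
        (\<Sum>s\<in>cv ` {..<m}. cost m E cv ce Y s lam (om s)) \<le> (\<Sum>s\<in>cv ` {..<m}. cost m E cv ce Y s lam' (om' s))))"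
    (is "_ \<longleftrightarrow> ?R")
proof -
  have "is_mle (rdag_model m E cv ce) Y P \<longleftrightarrow>
    (\<exists>lam om. (\<forall>s. om s > 0) \<and> P = Psi m E cv ce lam om) \<and>
    (\<forall>lam' om'. (\<forall>s. om' s > 0) \<longrightarrow> log_lik Y (Psi m E cv ce lam' om') \<le> log_lik Y P)"
  proof -
    have "is_mle M Y P \<longleftrightarrow> P \<in> M \<and> (\<forall>Q\<in>M. log_lik Y Q \<le> log_lik Y P)" for M
      unfolding is_mle_def is_arg_max_def by (auto simp: not_less)
    moreover have "(\<forall>Q\<in>rdag_model m E cv ce. R Q) \<longleftrightarrow>
        (\<forall>lam om. (\<forall>s. om s > 0) \<longrightarrow> R (Psi m E cv ce lam om))" for R
      unfolding rdag_model_eq[OF dag] by auto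
    moreover have "P \<in> rdag_model m E cv ce \<longleftrightarrow> (\<exists>lam om. (\<forall>s. om s > 0) \<and> P = Psi m E cv ce lam om)"
      unfolding rdag_model_eq[OF dag] mem_Collect_eq by (intro ex_cong1 conj_commute)
    ultimately show ?thesis by simp
  qed
  also have "\<dots> \<longleftrightarrow> (\<exists>lam om. (\<forall>s. om s > 0) \<and> P = Psi m E cv ce lam om \<and>
     (\<forall>lam' om'. (\<forall>s. om' s > 0) \<longrightarrow>
        log_lik Y (Psi m E cv ce lam' om') \<le> log_lik Y (Psi m E cv ce lam om)))"
    by auto
  also have "\<dots> \<longleftrightarrow> ?R"
  proof -
    have "log_lik Y (Psi m E cv ce lam om) = - (\<Sum>s\<in>cv ` {..<m}. cost m E cv ce Y s lam (om s))"
      if "\<forall>s. om s > 0" for lam om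
      using that by (intro log_lik_Psi[OF dag _ Y]) auto
    thus ?thesis by (simp cong: conj_cong imp_cong)
  qed
  finally show ?thesis .
qed

lemma mle_exists:
  assumes dag: "ordered_dag m E" and comp: "compatible m E cv ce"
    and Y: "Y \<in> carrier_mat m n" and n: "n > 0"
    and nspan: "\<And>s. s \<in> cv ` {..<m} \<Longrightarrow>
      \<not> in_span (cells m cv n s) (prc E cv ce s) (parent_sum E ce Y) (\<lambda>x. Y $$ x)"
  shows "\<exists>P. is_mle (rdag_model m E cv ce) Y P"
    and "(\<And>s. s \<in> cv ` {..<m} \<Longrightarrow> indep (cells m cv n s) (prc E cv ce s) (parent_sum E ce Y)) \<Longrightarrow>
      \<exists>!P. is_mle (rdag_model m E cv ce) Y P"
proof -
  let ?S = "cv ` {..<m}" and ?cost = "cost m E cv ce Y"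
  have n': "dim_col Y > 0" "dim_col Y = n" using Y n by auto
  have "\<forall>s\<in>?S. \<exists>c w0. w0 > 0 \<and> (\<forall>lam w. w > 0 \<longrightarrow> ?cost s c w0 \<le> ?cost s lam w) \<and>
    (\<forall>lam w. indep (cells m cv n s) (prc E cv ce s) (parent_sum E ce Y) \<longrightarrow>
       w > 0 \<longrightarrow> ?cost s lam w = ?cost s c w0 \<longrightarrow> w = w0 \<and> (\<forall>t\<in>prc E cv ce s. lam t = c t))"
  proof
    fix s assume s: "s \<in> ?S"
    show "\<exists>c w0. w0 > 0 \<and> (\<forall>lam w. w > 0 \<longrightarrow> ?cost s c w0 \<le> ?cost s lam w) \<and>
    (\<forall>lam w. indep (cells m cv n s) (prc E cv ce s) (parent_sum E ce Y) \<longrightarrow>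
       w > 0 \<longrightarrow> ?cost s lam w = ?cost s c w0 \<longrightarrow> w = w0 \<and> (\<forall>t\<in>prc E cv ce s. lam t = c t))"
    proof (rule cost_minimiser[OF dag s n'(1) nspan[OF s, folded n'(2)]])
      fix c w0
      assume "w0 > 0" "\<And>lam w. w > 0 \<Longrightarrow> ?cost s c w0 \<le> ?cost s lam w"
        "\<And>lam w t. indep (cells m cv (dim_col Y) s) (prc E cv ce s) (parent_sum E ce Y) \<Longrightarrow>
          w > 0 \<Longrightarrow> ?cost s lam w = ?cost s c w0 \<Longrightarrow> w = w0 \<and> (\<forall>t\<in>prc E cv ce s. lam t = c t)"
      thus ?thesis unfolding n'(2) by (intro exI[of _ c] exI[of _ w0]) simp
    qed
  qed
  then obtain c w0 where w0: "\<And>s. s \<in> ?S \<Longrightarrow> w0 s > 0"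
    and min: "\<And>s lam w. s \<in> ?S \<Longrightarrow> w > 0 \<Longrightarrow> ?cost s (c s) (w0 s) \<le> ?cost s lam w"
    and uniq: "\<And>s lam w. s \<in> ?S \<Longrightarrow> indep (cells m cv n s) (prc E cv ce s) (parent_sum E ce Y) \<Longrightarrow>
       w > 0 \<Longrightarrow> ?cost s lam w = ?cost s (c s) (w0 s) \<Longrightarrow> w = w0 s \<and> (\<forall>t\<in>prc E cv ce s. lam t = c s t)"
    by metis
  obtain lam where lam: "\<And>s t. t \<in> prc E cv ce s \<Longrightarrow> lam t = c s t" using combine_colours[OF comp] by blast
  define om where "om s = (if s \<in> ?S then w0 s else 1)" for s
  have om: "om s > 0" for s using w0 unfolding om_def by simp
  have costlam: "?cost s lam (om s) = ?cost s (c s) (w0 s)" if "s \<in> ?S" for s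
    using that rss_cong[of E cv ce s lam "c s" m Y] lam unfolding cost_def om_def by simp
  have mle: "is_mle (rdag_model m E cv ce) Y (Psi m E cv ce lam om)"
    unfolding is_mle_iff[OF dag Y] using om min costlam
    by (intro exI[of _ lam] exI[of _ om]) (auto intro!: sum_mono)
  thus "\<exists>P. is_mle (rdag_model m E cv ce) Y P" ..
  assume ind: "\<And>s. s \<in> ?S \<Longrightarrow> indep (cells m cv n s) (prc E cv ce s) (parent_sum E ce Y)"
  show "\<exists>!P. is_mle (rdag_model m E cv ce) Y P"
  proof (rule ex1I, rule mle)
    fix P assume "is_mle (rdag_model m E cv ce) Y P"
    then obtain lam' om' where P: "\<And>s. om' s > 0" "P = Psi m E cv ce lam' om'"
      and le: "(\<Sum>s\<in>?S. ?cost s lam' (om' s)) \<le> (\<Sum>s\<in>?S. ?cost s lam (om s))"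
      unfolding is_mle_iff[OF dag Y] using om by blast
    have ge: "?cost s lam (om s) \<le> ?cost s lam' (om' s)" if "s \<in> ?S" for s
      using min[OF that P(1)] costlam[OF that] by simp
    have "(\<Sum>s\<in>?S. ?cost s lam' (om' s) - ?cost s lam (om s)) = 0"
      using le sum_mono[of ?S "\<lambda>s. ?cost s lam (om s)" "\<lambda>s. ?cost s lam' (om' s)"] ge by (simp add: sum_subtractf)
    hence zero: "\<forall>s\<in>?S. ?cost s lam' (om' s) - ?cost s lam (om s) = 0"
      using ge by (subst (asm) sum_nonneg_eq_0_iff) auto
    have eq: "?cost s lam' (om' s) = ?cost s (c s) (w0 s)" if "s \<in> ?S" for s
      using bspec[OF zero that] costlam[OF that] by linarith
    show "P = Psi m E cv ce lam om"
      unfolding P(2)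
    proof (rule Psi_cong[OF dag P(1) om])
      show "lam' t = lam t" if "s \<in> ?S" "t \<in> prc E cv ce s" for s t
        using uniq[OF that(1) ind[OF that(1)] P(1) eq[OF that(1)]] lam[OF that(2)] that(2) by simp
      show "om' s = om s" if "s \<in> ?S" for s
        using uniq[OF that ind[OF that] P(1) eq[OF that]] that unfolding om_def by simp
    qed
  qed
qed

text \<open>With residual zero, the likelihood increases whenever the variance \<open>\<omega>\<^sub>s\<close> is halved.\<close>

lemma no_mle_if_in_span:
  assumes dag: "ordered_dag m E" and comp: "compatible m E cv ce"
    and Y: "Y \<in> carrier_mat m n" and s: "s \<in> cv ` {..<m}"
    and span: "in_span (cells m cv n s) (prc E cv ce s) (parent_sum E ce Y) (\<lambda>x. Y $$ x)"
  shows "\<not> is_mle (rdag_model m E cv ce) Y P"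
proof
  let ?S = "cv ` {..<m}" and ?cost = "cost m E cv ce Y"
  assume "is_mle (rdag_model m E cv ce) Y P"
  then obtain lam om where om: "\<And>s. om s > 0"
    and min: "\<And>lam' om'. (\<And>s. om' s > 0) \<Longrightarrow> (\<Sum>s\<in>?S. ?cost s lam (om s)) \<le> (\<Sum>s\<in>?S. ?cost s lam' (om' s))"
    unfolding is_mle_iff[OF dag Y] by blast
  have dim: "dim_col Y = n" using Y by simp
  obtain c where c: "rss m E cv ce Y s c = 0" using span unfolding rss_eq_0_iff in_span_def dim by blast
  define lam' where "lam' t = (if t \<in> prc E cv ce s then c t else lam t)" for t
  define om' where "om' = om(s := om s / 2)"
  have rs: "rss m E cv ce Y s lam' = 0"
    unfolding c[symmetric] by (rule rss_cong) (simp add: lam'_def)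
  have "?cost s lam' (om' s) < ?cost s lam (om s)"
  proof -
    have "?cost s lam' (om' s) = real (alpha m cv s) * ln (om s / 2)"
      unfolding cost_def rs om'_def by simp
    also have "\<dots> < real (alpha m cv s) * ln (om s)"
      using alpha_pos[OF s] om[of s] by simp
    also have "\<dots> \<le> ?cost s lam (om s)"
      unfolding cost_def using rss_nonneg[of m E cv ce Y s lam] om[of s] by simp
    finally show ?thesis .
  qed
  moreover have "?cost u lam' (om' u) = ?cost u lam (om u)" if "u \<noteq> s" for u
  proof -
    have "rss m E cv ce Y u lam' = rss m E cv ce Y u lam"
      using prc_disjoint[OF comp] that by (intro rss_cong) (auto simp: lam'_def)
    thus ?thesis using that unfolding cost_def om'_def by simp
  qed
  ultimately have "(\<Sum>u\<in>?S. ?cost u lam' (om' u)) < (\<Sum>u\<in>?S. ?cost u lam (om u))"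
    using s by (intro sum_strict_mono_ex1) (auto, metis order_refl less_imp_le)
  moreover have "om' u > 0" for u using om[of u] om[of s] unfolding om'_def by simp
  ultimately show False using min[of om' lam'] by fastforce
qed

text \<open>Otherwise \<open>M'\<close> has at least as many rows as columns. As an MLE exists, the rows do not span
  everything, so there is a dependency \<open>v\<close> between them, and adding \<open>v\<close> to the coefficients of an
  MLE gives a second one.\<close>

lemma unique_mle_imp_beta_less:
  assumes dag: "ordered_dag m E" and comp: "compatible m E cv ce"
    and Y: "Y \<in> carrier_mat m n" and s: "s \<in> cv ` {..<m}"
    and ex1: "\<exists>!P. is_mle (rdag_model m E cv ce) Y P"
  shows "beta E cv ce s < alpha m cv s * n"
proof (rule ccontr)
  assume nless: "\<not> ?thesis"
  let ?S = "cv ` {..<m}" and ?cost = "cost m E cv ce Y"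
  let ?X = "cells m cv n s" and ?T = "prc E cv ce s" and ?f = "parent_sum E ce Y"
  have dim: "dim_col Y = n" using Y by simp
  have "card ?X \<le> card ?T" using nless unfolding card_cells beta_def by simp
  moreover have "\<not> in_span ?X ?T ?f (\<lambda>x. Y $$ x)" using no_mle_if_in_span[OF dag comp Y s] ex1 by blast
  ultimately have "\<not> indep ?X ?T ?f"
    using in_span_if_indep_card[of ?X ?T ?f "\<lambda>x. Y $$ x"] finite_prc[OF dag, of cv ce s] by auto
  then obtain v t where v: "\<And>x. x \<in> ?X \<Longrightarrow> (\<Sum>t\<in>?T. v t * ?f t x) = 0" and t: "t \<in> ?T" "v t \<noteq> 0"
    unfolding indep_def by blast
  obtain P where P: "is_mle (rdag_model m E cv ce) Y P" using ex1 by blast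
  then obtain lam om where om: "\<And>s. om s > 0" "P = Psi m E cv ce lam om"
    and min: "\<And>lam' om'. (\<And>s. om' s > 0) \<Longrightarrow> (\<Sum>s\<in>?S. ?cost s lam (om s)) \<le> (\<Sum>s\<in>?S. ?cost s lam' (om' s))"
    unfolding is_mle_iff[OF dag Y] by blast
  define lam' where "lam' t = (if t \<in> ?T then lam t + v t else lam t)" for t
  have "rss m E cv ce Y u lam' = rss m E cv ce Y u lam" for u
  proof (cases "u = s")
    case True
    have "(\<Sum>t\<in>?T. lam' t * ?f t x) = (\<Sum>t\<in>?T. lam t * ?f t x)" if "x \<in> ?X" for x
    proof -
      have "(\<Sum>t\<in>?T. lam' t * ?f t x) = (\<Sum>t\<in>?T. lam t * ?f t x) + (\<Sum>t\<in>?T. v t * ?f t x)"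
        unfolding sum.distrib[symmetric] by (intro sum.cong) (auto simp: lam'_def algebra_simps)
      thus ?thesis using v[OF that] by simp
    qed
    thus ?thesis unfolding rss_def True dim by (intro sum.cong) auto
  next
    case False
    thus ?thesis using prc_disjoint[OF comp] by (intro rss_cong) (auto simp: lam'_def)
  qed
  hence "?cost u lam' (om u) = ?cost u lam (om u)" for u unfolding cost_def by simp
  hence "is_mle (rdag_model m E cv ce) Y (Psi m E cv ce lam' om)"
    unfolding is_mle_iff[OF dag Y] using om(1) min by (intro exI[of _ lam'] exI[of _ om]) simp
  hence "Psi m E cv ce lam' om = Psi m E cv ce lam om" using ex1 P om(2) by blast
  moreover obtain j i where "(j, i) \<in> E" "t = ce (j, i)" using t(1) unfolding prc_def by blast
  ultimately have "lam' t = lam t" using Psi_inj_Lambda[where om = om, OF dag om(1)] by blast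
  thus False using t unfolding lam'_def by simp
qed

section \<open>Generic samples\<close>

lemma parent_sum_poly:
  assumes "ordered_dag m E" "snd x < n"
  shows "(\<lambda>Y. parent_sum E ce Y t x) \<in> poly_funs m n"
  unfolding parent_sum_def
  using assms by (intro poly_funs_sum poly_funs.entry) (auto simp: ordered_dag_def)

text \<open>Let \<open>T\<close> be a set of rows of \<open>M'\<close> that generically is a basis of the row span, and \<open>y\<^sub>s\<close> the
  vector of the samples at the vertices of colour \<open>s\<close>. Then \<open>y\<^sub>s\<close> is outside the row span wherever the Gram determinant of \<open>T\<close> and \<open>y\<^sub>s\<close> does not vanish, and this
  determinant is not the zero polynomial.\<close>

lemma generically_not_in_span:
  assumes dag: "ordered_dag m E" and nosame: "\<forall>(j, i) \<in> E. cv j \<noteq> cv i"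
    and less: "beta E cv ce s < alpha m cv s * n"
  shows "generically m n (\<lambda>Y. \<not> in_span (cells m cv n s) (prc E cv ce s) (parent_sum E ce Y) (\<lambda>x. Y $$ x))"
proof -
  let ?X = "cells m cv n s" and ?U = "prc E cv ce s"
  have cell: "fst x < m" "snd x < n" "cv (fst x) = s" if "x \<in> ?X" for x
    using that unfolding cells_def vertices_of_def by auto
  have poly: "(\<lambda>Y. parent_sum E ce Y t x) \<in> poly_funs m n" if "x \<in> ?X" for t x
    using parent_sum_poly[OF dag cell(2)[OF that]] .
  obtain T Y0 where T: "T \<subseteq> ?U" and Y0: "Y0 \<in> carrier_mat m n" "indep ?X T (parent_sum E ce Y0)"
    and max: "\<forall>T'\<subseteq>?U. \<forall>Y\<in>carrier_mat m n. indep ?X T' (parent_sum E ce Y) \<longrightarrow> card T' \<le> card T"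
    by (rule maximal_indep_exists[of ?U m n ?X "parent_sum E ce", OF finite_prc[OF dag]])
  have finT: "finite T" by (rule finite_subset[OF T finite_prc[OF dag]])
  let ?F = "\<lambda>Y. case_option (\<lambda>x. Y $$ x) (parent_sum E ce Y)"
  have polyF: "(\<lambda>Y. ?F Y t x) \<in> poly_funs m n" if "x \<in> ?X" for t x
    using poly[OF that] poly_funs.entry[of "fst x" m "snd x" n] cell[OF that] by (cases t) auto
  obtain q where q: "q \<in> poly_funs m n" "\<And>Y. q Y \<noteq> 0 \<longleftrightarrow> indep ?X (insert None (Some ` T)) (?F Y)"
    by (rule indep_polynomial[of "insert None (Some ` T)" ?X ?F m n]) (use polyF finT in auto)
  have "card T < card ?X"
    using card_mono[OF finite_prc[OF dag] T] less unfolding card_cells beta_def by simp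
  then obtain g where g: "\<not> in_span ?X T (parent_sum E ce Y0) g"
    using exists_not_in_span[OF finite_cells finT, of m cv n s "parent_sum E ce Y0"] by blast
  \<comment> \<open>No vertex of colour \<open>s\<close> has a parent of colour \<open>s\<close>, so the rows of \<open>Y0\<close> of colour \<open>s\<close> can
    be overwritten by \<open>g\<close> without changing the parent sums.\<close>
  define Y1 where "Y1 = mat m n (\<lambda>x. if cv (fst x) = s then g x else Y0 $$ x)"
  have Y1: "Y1 \<in> carrier_mat m n" unfolding Y1_def by simp
  have same: "parent_sum E ce Y1 t x = parent_sum E ce Y0 t x" if "x \<in> ?X" for t x
    unfolding parent_sum_def
  proof (rule sum.cong)
    fix j assume "j \<in> {j. (j, fst x) \<in> E \<and> ce (j, fst x) = t}"
    hence "j < m" "cv j \<noteq> s" using nosame dag cell(3)[OF that] unfolding ordered_dag_def by auto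
    thus "Y1 $$ (j, snd x) = Y0 $$ (j, snd x)" using cell(2)[OF that] unfolding Y1_def by simp
  qed simp
  have "Y1 $$ x = g x" if "x \<in> ?X" for x
    using cell[OF that] unfolding Y1_def by (cases x) simp
  hence "\<not> in_span ?X T (parent_sum E ce Y1) (\<lambda>x. Y1 $$ x)"
    using g same unfolding in_span_def by simp
  moreover have "indep ?X T (parent_sum E ce Y1)" using Y0(2) same indep_cong[of T ?X "parent_sum E ce Y1"] by blast
  ultimately have "q Y1 \<noteq> 0" unfolding q(2) by (simp add: indep_option_iff[OF finT])
  moreover have "\<not> in_span ?X ?U (parent_sum E ce Y) (\<lambda>x. Y $$ x)"
    if Y: "Y \<in> carrier_mat m n" "q Y \<noteq> 0" for Y
  proof
    assume span: "in_span ?X ?U (parent_sum E ce Y) (\<lambda>x. Y $$ x)"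
    have ind: "indep ?X T (parent_sum E ce Y)" "\<not> in_span ?X T (parent_sum E ce Y) (\<lambda>x. Y $$ x)"
      using Y(2) unfolding q(2) by (simp_all add: indep_option_iff[OF finT])
    have "\<not> indep ?X (insert u T) (parent_sum E ce Y)" if "u \<in> ?U - T" for u
    proof
      assume "indep ?X (insert u T) (parent_sum E ce Y)"
      hence "card (insert u T) \<le> card T" using max T Y(1) that by blast
      thus False using that finT by simp
    qed
    from in_span_maximal[OF finite_prc[OF dag] T ind(1) this span] ind(2) show False by blast
  qed
  ultimately show ?thesis unfolding generically_def using q(1) Y1 by blast
qed

lemma set_prc_list:
  assumes "ordered_dag m E"
  shows "distinct (prc_list E cv ce s)" "set (prc_list E cv ce s) = prc E cv ce s"
proof -
  have "\<exists>ts. distinct ts \<and> set ts = prc E cv ce s"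
    using finite_distinct_list[OF finite_prc[OF assms, of cv ce s]] by blast
  from someI_ex[OF this] show "distinct (prc_list E cv ce s)" "set (prc_list E cv ce s) = prc E cv ce s"
    unfolding prc_list_def by (rule conjunct1, rule conjunct2)
qed

lemma M_prime_one_sample:
  assumes "Y \<in> carrier_mat m 1"
  shows "M_prime m E cv ce s Y \<in> carrier_mat (beta E cv ce s) (alpha m cv s)"
    and "a < beta E cv ce s \<Longrightarrow> b < alpha m cv s \<Longrightarrow> M_prime m E cv ce s Y $$ (a, b) =
      parent_sum E ce Y (prc_list E cv ce s ! a) (sorted_list_of_set (vertices_of m cv s) ! b, 0)"
  using assms unfolding M_prime_def parent_sum_def by (auto simp: Let_def)

lemma r_gen_generically:
  assumes "ordered_dag m E"
  shows "generically m 1 (\<lambda>Y. mat_rank (M_prime m E cv ce s Y) = r_gen m E cv ce s)"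
proof -
  define A where "A Y = mat (beta E cv ce s) (alpha m cv s) (\<lambda>(a, b).
    parent_sum E ce Y (prc_list E cv ce s ! a) (sorted_list_of_set (vertices_of m cv s) ! b, 0))" for Y
  have AM: "M_prime m E cv ce s Y = A Y" if "Y \<in> carrier_mat m 1" for Y
    using M_prime_one_sample(1)[OF that, of E cv ce s] M_prime_one_sample(2)[OF that, of _ E cv ce s]
    unfolding A_def by (intro eq_matI) auto
  have "generically m 1 (\<lambda>Y. mat_rank (A Y) = generic_rank m 1 A)"
    by (rule generic_rank_generically[where k = "beta E cv ce s" and l = "alpha m cv s"])
      (auto simp: A_def intro!: parent_sum_poly[OF assms])
  moreover have gen: "generically m 1 (\<lambda>Y. mat_rank (A Y) = r) \<longleftrightarrow> generically m 1 (\<lambda>Y. mat_rank (M_prime m E cv ce s Y) = r)" for r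
    unfolding generically_def by (simp add: AM cong: ball_cong)
  moreover have "generic_rank m 1 A = r_gen m E cv ce s"
    unfolding r_gen_def generic_rank_def gen ..
  ultimately show ?thesis by simp
qed

lemma indep_rows_M_prime:
  assumes dag: "ordered_dag m E" and Y: "Y \<in> carrier_mat m 1"
  obtains T where "T \<subseteq> prc E cv ce s" "card T = mat_rank (M_prime m E cv ce s Y)"
    "indep (cells m cv 1 s) T (parent_sum E ce Y)"
proof -
  define ts where "ts = prc_list E cv ce s"
  define vs where "vs = sorted_list_of_set (vertices_of m cv s)"
  have ts: "distinct ts" "set ts = prc E cv ce s" "length ts = beta E cv ce s"
    using set_prc_list[OF dag, of cv ce s] distinct_card[of ts] unfolding ts_def beta_def by auto
  have vs: "set vs = vertices_of m cv s" "length vs = alpha m cv s" unfolding vs_def alpha_def by auto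
  let ?M = "M_prime m E cv ce s Y"
  obtain R where R: "R \<subseteq> {..<beta E cv ce s}" "card R = mat_rank ?M"
    "indep {..<alpha m cv s} R (\<lambda>a b. ?M $$ (a, b))"
    "\<forall>T\<subseteq>{..<beta E cv ce s}. indep {..<alpha m cv s} T (\<lambda>a b. ?M $$ (a, b)) \<longrightarrow> card T \<le> mat_rank ?M"
    by (rule mat_rank_indep_rows[OF M_prime_one_sample(1)[OF Y, of E cv ce s]])
  have inj: "inj_on ((!) ts) R" using R(1) ts by (intro inj_on_nth) auto
  show thesis
  proof (rule that[of "(!) ts ` R"])
    show "(!) ts ` R \<subseteq> prc E cv ce s" using R(1) ts by (force simp flip: ts(2))
    show "card ((!) ts ` R) = mat_rank ?M" using card_image[OF inj] R(2) by simp
    show "indep (cells m cv 1 s) ((!) ts ` R) (parent_sum E ce Y)"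
    proof (rule indepI)
      fix c t
      assume c: "\<And>x. x \<in> cells m cv 1 s \<Longrightarrow> (\<Sum>t\<in>(!) ts ` R. c t * parent_sum E ce Y t x) = 0"
        and t: "t \<in> (!) ts ` R"
      have "(\<Sum>a\<in>R. c (ts ! a) * ?M $$ (a, b)) = 0" if b: "b \<in> {..<alpha m cv s}" for b
      proof -
        have "(vs ! b, 0) \<in> cells m cv 1 s" using b vs unfolding cells_def by (force simp flip: vs(1))
        from c[OF this] have "(\<Sum>a\<in>R. c (ts ! a) * parent_sum E ce Y (ts ! a) (vs ! b, 0)) = 0"
          unfolding sum.reindex[OF inj] by simp
        moreover have "?M $$ (a, b) = parent_sum E ce Y (ts ! a) (vs ! b, 0)" if "a \<in> R" for a
          using M_prime_one_sample(2)[OF Y, of a E cv ce s b] that R(1) b unfolding ts_def vs_def by blast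
        ultimately show ?thesis by simp
      qed
      from indepD[OF R(3), of "\<lambda>a. c (ts ! a)", OF this] show "c t = 0" using t by blast
    qed
  qed
qed

text \<open>The sample \<open>Y\<close> is a point at which the generic rank is attained.\<close>

lemma r_gen_witness:
  assumes "ordered_dag m E"
  obtains Y T where "Y \<in> carrier_mat m 1" "T \<subseteq> prc E cv ce s" "card T = r_gen m E cv ce s"
    "indep (cells m cv 1 s) T (parent_sum E ce Y)"
proof -
  obtain Y where Y: "Y \<in> carrier_mat m 1" "mat_rank (M_prime m E cv ce s Y) = r_gen m E cv ce s"
    using almost_all_imp_ex[OF generically_imp_almost_all[OF r_gen_generically[OF assms, of cv ce s]]] by blast
  obtain T where "T \<subseteq> prc E cv ce s" "card T = mat_rank (M_prime m E cv ce s Y)"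
    "indep (cells m cv 1 s) T (parent_sum E ce Y)"
    by (rule indep_rows_M_prime[OF assms Y(1)])
  thus thesis using that[OF Y(1)] Y(2) by simp
qed

lemma r_gen_le:
  assumes "ordered_dag m E"
  shows "r_gen m E cv ce s \<le> alpha m cv s" "r_gen m E cv ce s \<le> beta E cv ce s"
proof -
  obtain Y T where "Y \<in> carrier_mat m 1" and T: "T \<subseteq> prc E cv ce s" "card T = r_gen m E cv ce s"
    "indep (cells m cv 1 s) T (parent_sum E ce Y)"
    by (rule r_gen_witness[OF assms])
  have fin: "finite T" by (rule finite_subset[OF T(1) finite_prc[OF assms]])
  show "r_gen m E cv ce s \<le> alpha m cv s"
    using indep_card_le[OF finite_cells fin T(3)] T(2) unfolding card_cells by simp
  show "r_gen m E cv ce s \<le> beta E cv ce s"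
    using card_mono[OF finite_prc[OF assms] T(1)] T(2) unfolding beta_def by simp
qed

lemma r_gen_eq_alpha_in_span:
  assumes dag: "ordered_dag m E" and r: "r_gen m E cv ce s = alpha m cv s"
  shows "almost_all_samples m 1 (\<lambda>Y. in_span (cells m cv 1 s) (prc E cv ce s) (parent_sum E ce Y) (g Y))"
proof (rule almost_all_mono[OF generically_imp_almost_all[OF r_gen_generically[OF dag]]])
  fix Y assume Y: "Y \<in> carrier_mat m 1" "mat_rank (M_prime m E cv ce s Y) = r_gen m E cv ce s"
  obtain T where T: "T \<subseteq> prc E cv ce s" "card T = mat_rank (M_prime m E cv ce s Y)"
    "indep (cells m cv 1 s) T (parent_sum E ce Y)"
    by (rule indep_rows_M_prime[OF dag Y(1)])
  have fin: "finite T" by (rule finite_subset[OF T(1) finite_prc[OF dag]])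
  have "in_span (cells m cv 1 s) T (parent_sum E ce Y) (g Y)"
    using T(2) Y(2) r by (intro in_span_if_indep_card[OF finite_cells fin T(3)]) (simp add: card_cells)
  thus "in_span (cells m cv 1 s) (prc E cv ce s) (parent_sum E ce Y) (g Y)"
    using T(1) finite_prc[OF dag] by (rule in_span_mono)
qed

text \<open>The new sample is the unit vector at the parent \<open>j0\<close> of an edge \<open>j0 \<rightarrow> i0\<close> of colour \<open>u\<close>. At the
  new column \<open>(i0, k)\<close> the row of \<open>u\<close> has the entry \<open>1\<close> and all other rows vanish, so \<open>u\<close> does not
  occur in any dependency.\<close>

lemma add_sample:
  assumes dag: "ordered_dag m E" and T: "T \<subseteq> prc E cv ce s"
    and Y: "Y \<in> carrier_mat m k" "indep (cells m cv k s) T (parent_sum E ce Y)"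
    and u: "u \<in> prc E cv ce s - T"
  obtains Y' where "Y' \<in> carrier_mat m (Suc k)" "indep (cells m cv (Suc k) s) (insert u T) (parent_sum E ce Y')"
proof -
  have E: "j < m" "i < m" if "(j, i) \<in> E" for i j using dag that unfolding ordered_dag_def by auto
  obtain j0 i0 where e: "(j0, i0) \<in> E" "cv i0 = s" "u = ce (j0, i0)" using u unfolding prc_def by blast
  define Y' where "Y' = mat m (Suc k) (\<lambda>(j, b). if b < k then Y $$ (j, b) else if j = j0 then 1 else 0)"
  have fin: "finite T" by (rule finite_subset[OF T finite_prc[OF dag]])
  have old: "parent_sum E ce Y' t x = parent_sum E ce Y t x" if "x \<in> cells m cv k s" for t x
    using that E unfolding parent_sum_def cells_def by (intro sum.cong) (auto simp: Y'_def)
  have new: "parent_sum E ce Y' t (i0, k) = (if t = u then 1 else 0)" for t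
  proof -
    have "finite {j. (j, i0) \<in> E \<and> ce (j, i0) = t}"
      by (rule finite_subset[of _ "{..<m}"]) (auto dest: E(1))
    have "parent_sum E ce Y' t (i0, k) = (\<Sum>j | (j, i0) \<in> E \<and> ce (j, i0) = t. if j = j0 then 1 else 0)"
      using E unfolding parent_sum_def by (intro sum.cong) (auto simp: Y'_def)
    also have "(\<Sum>j | (j, i0) \<in> E \<and> ce (j, i0) = t. if j = j0 then 1 else 0) = (if t = u then 1 else (0::real))"
      using e \<open>finite {j. (j, i0) \<in> E \<and> ce (j, i0) = t}\<close> by (simp add: sum.delta)
    finally show ?thesis .
  qed
  have "indep (cells m cv (Suc k) s) (insert u T) (parent_sum E ce Y')"
  proof (rule indepI)
    fix c t
    assume c: "\<And>x. x \<in> cells m cv (Suc k) s \<Longrightarrow> (\<Sum>t\<in>insert u T. c t * parent_sum E ce Y' t x) = 0"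
      and t: "t \<in> insert u T"
    have "(i0, k) \<in> cells m cv (Suc k) s" using e E[OF e(1)] unfolding cells_def vertices_of_def by auto
    from c[OF this] have cu: "c u = 0"
      unfolding new using fin u by (simp add: sum.neutral if_distrib cong: if_cong)
    have "(\<Sum>t\<in>T. c t * parent_sum E ce Y t x) = 0" if "x \<in> cells m cv k s" for x
    proof -
      have "x \<in> cells m cv (Suc k) s" using that unfolding cells_def by auto
      from c[OF this] show ?thesis using fin u cu old[OF that] by simp
    qed
    from indepD[OF Y(2) this] show "c t = 0" using t cu by blast
  qed
  thus thesis using that[of Y'] unfolding Y'_def by simp
qed

text \<open>The condition says \<open>n \<ge> \<beta>\<^sub>s + 1 - r\<^sub>s\<close>, without subtraction of natural numbers.\<close>

lemma indep_samples_exist: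
  assumes dag: "ordered_dag m E" and n: "beta E cv ce s + 1 \<le> n + r_gen m E cv ce s" "n \<ge> 1"
  shows "\<exists>Y\<in>carrier_mat m n. indep (cells m cv n s) (prc E cv ce s) (parent_sum E ce Y)"
proof -
  have "\<exists>T Y. T \<subseteq> prc E cv ce s \<and> Y \<in> carrier_mat m (Suc q) \<and>
      indep (cells m cv (Suc q) s) T (parent_sum E ce Y) \<and>
      min (beta E cv ce s) (r_gen m E cv ce s + q) \<le> card T" for q
  proof (induction q)
    case 0
    obtain Y T where "Y \<in> carrier_mat m 1" "T \<subseteq> prc E cv ce s" "card T = r_gen m E cv ce s"
      "indep (cells m cv 1 s) T (parent_sum E ce Y)"
      by (rule r_gen_witness[OF dag])
    thus ?case by (intro exI[of _ T] exI[of _ Y]) simp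
  next
    case (Suc q)
    then obtain T Y where T: "T \<subseteq> prc E cv ce s" and Y: "Y \<in> carrier_mat m (Suc q)"
      "indep (cells m cv (Suc q) s) T (parent_sum E ce Y)"
      and card: "min (beta E cv ce s) (r_gen m E cv ce s + q) \<le> card T" by blast
    have fin: "finite T" by (rule finite_subset[OF T finite_prc[OF dag]])
    show ?case
    proof (cases "T = prc E cv ce s")
      case False
      then obtain u where u: "u \<in> prc E cv ce s - T" using T by blast
      obtain Y' where Y': "Y' \<in> carrier_mat m (Suc (Suc q))"
        "indep (cells m cv (Suc (Suc q)) s) (insert u T) (parent_sum E ce Y')"
        by (rule add_sample[OF dag T Y u])
      have "card (insert u T) = Suc (card T)" using u fin by simp
      thus ?thesis using Y' T u card by (intro exI[of _ "insert u T"] exI[of _ Y']) auto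
    next
      case True
      define Y' where "Y' = mat m (Suc (Suc q)) (\<lambda>(j, b). if b < Suc q then Y $$ (j, b) else 0)"
      have "parent_sum E ce Y' t x = parent_sum E ce Y t x" if "x \<in> cells m cv (Suc q) s" for t x
        using that dag unfolding parent_sum_def cells_def ordered_dag_def by (intro sum.cong) (auto simp: Y'_def)
      hence "indep (cells m cv (Suc q) s) T (parent_sum E ce Y')"
        using Y(2) indep_cong[of T "cells m cv (Suc q) s" "parent_sum E ce Y'"] by blast
      moreover have "cells m cv (Suc q) s \<subseteq> cells m cv (Suc (Suc q)) s" unfolding cells_def by auto
      ultimately have "indep (cells m cv (Suc (Suc q)) s) T (parent_sum E ce Y')" by (rule indep_subset_cols)
      thus ?thesis using T by (intro exI[of _ T] exI[of _ Y']) (auto simp: Y'_def True beta_def)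
    qed
  qed
  from this[of "n - 1"] obtain T Y where T: "T \<subseteq> prc E cv ce s" and Y: "Y \<in> carrier_mat m n"
    "indep (cells m cv n s) T (parent_sum E ce Y)" and card: "beta E cv ce s \<le> card T"
    using n by auto
  have "T = prc E cv ce s" using card_seteq[OF finite_prc[OF dag] T] card unfolding beta_def by simp
  thus ?thesis using Y by blast
qed

lemma almost_all_indep:
  assumes dag: "ordered_dag m E" and n: "beta E cv ce s + 1 \<le> n + r_gen m E cv ce s" "n \<ge> 1"
  shows "almost_all_samples m n (\<lambda>Y. indep (cells m cv n s) (prc E cv ce s) (parent_sum E ce Y))"
proof -
  have "(\<lambda>Y. parent_sum E ce Y t x) \<in> poly_funs m n" if "x \<in> cells m cv n s" for t x
    using that by (intro parent_sum_poly[OF dag]) (auto simp: cells_def)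
  then obtain p where p: "p \<in> poly_funs m n" "\<And>Y. p Y \<noteq> 0 \<longleftrightarrow> indep (cells m cv n s) (prc E cv ce s) (parent_sum E ce Y)"
    by (rule indep_polynomial[of "prc E cv ce s" "cells m cv n s" "parent_sum E ce" m n, OF finite_prc[OF dag] _ finite_cells]) auto
  thus ?thesis
    using indep_samples_exist[OF assms] by (intro generically_imp_almost_all) (auto simp: generically_def)
qed

section \<open>The thresholds\<close>

lemma threshold_attained:
  assumes "P n0" "n0 \<ge> (1::nat)"
  shows "\<exists>k. Inf {enat n | n. n \<ge> 1 \<and> P n} = enat k \<and> k \<ge> 1 \<and> P k \<and> k \<le> n0"
proof -
  let ?A = "{enat n | n. n \<ge> 1 \<and> P n}"
  have mem: "enat n0 \<in> ?A" using assms by blast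
  hence "Inf ?A \<in> ?A" unfolding Inf_enat_def using LeastI[of "\<lambda>x. x \<in> ?A"] by auto
  then obtain k where k: "Inf ?A = enat k" "k \<ge> 1" "P k" by blast
  moreover have "Inf ?A \<le> enat n0" using mem by (rule Inf_lower)
  ultimately show ?thesis by (intro exI[of _ k]) simp
qed

theorem theorem5p3:
  fixes m :: nat and E :: "(nat \<times> nat) set"
    and cv :: "nat \<Rightarrow> 'c" and ce :: "nat \<times> nat \<Rightarrow> 'c"
  assumes "m \<ge> 1"
    and "ordered_dag m E"
    and "compatible m E cv ce"
    and "\<forall>(j, i) \<in> E. cv j \<noteq> cv i"
  defines "S \<equiv> cv ` {..<m}"
    and "\<alpha> \<equiv> alpha m cv"
    and "\<beta> \<equiv> beta E cv ce"
    and "r \<equiv> r_gen m E cv ce"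
  shows "\<exists>ne nu :: nat. mlt_e m E cv ce = enat ne \<and> mlt_u m E cv ce = enat nu \<and>
    ({s \<in> S. \<alpha> s \<ge> 2} \<noteq> {} \<longrightarrow>
       Max ((\<lambda>s. \<lfloor>(real (r s) - 1) / (real (\<alpha> s) - 1)\<rfloor> + 1) ` {s \<in> S. \<alpha> s \<ge> 2}) \<le> int ne) \<and>
    int ne \<le> Max ((\<lambda>s. \<lfloor>real (\<beta> s) / real (\<alpha> s)\<rfloor>) ` S) + 1 \<and>
    Max ((\<lambda>s. \<lfloor>real (\<beta> s) / real (\<alpha> s)\<rfloor>) ` S) + 1 \<le> int nu \<and>
    int nu \<le> Max ((\<lambda>s. int (\<beta> s) + 2 - int (r s)) ` S)"
proof -
  note dag = assms(2) and comp = assms(3)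
  let ?M = "rdag_model m E cv ce"
  have S: "finite S" "S \<noteq> {}" using assms(1) unfolding S_def by (auto simp: lessThan_empty_iff)
  have apos: "\<alpha> s > 0" if "s \<in> S" for s using alpha_pos[of s cv m] that unfolding S_def \<alpha>_def by blast
  have rle: "r s \<le> \<alpha> s" "r s \<le> \<beta> s" for s
    using r_gen_le[OF dag, of cv ce s] unfolding r_def \<alpha>_def \<beta>_def by auto
  have floor_less_iff': "\<lfloor>real (\<beta> s) / real (\<alpha> s)\<rfloor> < int n \<longleftrightarrow> \<beta> s < \<alpha> s * n" if "s \<in> S" for s n
  proof -
    have "\<lfloor>real (\<beta> s) / real (\<alpha> s)\<rfloor> < int n \<longleftrightarrow> real (\<beta> s) / real (\<alpha> s) < real n"
      by (simp add: floor_less_iff)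
    also have "\<dots> \<longleftrightarrow> real (\<beta> s) < real (\<alpha> s * n)" using apos[OF that] by (simp add: divide_less_eq mult.commute)
    finally show ?thesis by linarith
  qed
  have exist: "almost_all_samples m n (\<lambda>Y. \<forall>s\<in>S. \<not> in_span (cells m cv n s) (prc E cv ce s) (parent_sum E ce Y) (\<lambda>x. Y $$ x))"
    if "\<And>s. s \<in> S \<Longrightarrow> \<beta> s < \<alpha> s * n" for n
    using that S(1)
    by (intro almost_all_ball generically_imp_almost_all generically_not_in_span[OF dag assms(4)])
      (auto simp: \<alpha>_def \<beta>_def)
  \<comment> \<open>\<open>B + 1\<close> is the bound that separates the two thresholds, \<open>C\<close> the upper bound on \<open>mlt_u\<close>.\<close>
  define B where "B = Max ((\<lambda>s. \<lfloor>real (\<beta> s) / real (\<alpha> s)\<rfloor>) ` S)"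
  have B: "\<lfloor>real (\<beta> s) / real (\<alpha> s)\<rfloor> \<le> B" if "s \<in> S" for s
    unfolding B_def using S(1) that by (intro Max_ge) auto
  have B0: "B \<ge> 0"
  proof -
    obtain s where s: "s \<in> S" using S(2) by blast
    have "0 \<le> \<lfloor>real (\<beta> s) / real (\<alpha> s)\<rfloor>" by simp
    thus ?thesis using B[OF s] by linarith
  qed
  define C where "C = Max ((\<lambda>s. int (\<beta> s) + 2 - int (r s)) ` S)"
  have C: "int (\<beta> s) + 2 - int (r s) \<le> C" if "s \<in> S" for s
    unfolding C_def using S(1) that by (intro Max_ge) auto
  have C2: "C \<ge> 2"
  proof -
    obtain s where s: "s \<in> S" using S(2) by blast
    show ?thesis using C[OF s] rle(2)[of s] by linarith
  qed
  have "almost_all_samples m (nat (B + 1)) (\<lambda>Y. \<exists>P. is_mle ?M Y P)"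
  proof (rule almost_all_mono[OF exist])
    show "\<beta> s < \<alpha> s * nat (B + 1)" if "s \<in> S" for s
      using floor_less_iff'[OF that, of "nat (B + 1)"] B[OF that] B0 by linarith
    show "\<exists>P. is_mle ?M Y P" if "Y \<in> carrier_mat m (nat (B + 1))"
      "\<forall>s\<in>S. \<not> in_span (cells m cv (nat (B + 1)) s) (prc E cv ce s) (parent_sum E ce Y) (\<lambda>x. Y $$ x)" for Y
      using that B0 by (intro mle_exists(1)[OF dag comp]) (auto simp: S_def)
  qed
  moreover have "nat (B + 1) \<ge> 1" using B0 by simp
  ultimately obtain ne where ne: "mlt_e m E cv ce = enat ne" "ne \<ge> 1"
    "almost_all_samples m ne (\<lambda>Y. \<exists>P. is_mle ?M Y P)" "ne \<le> nat (B + 1)"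
    unfolding mlt_e_def
    using threshold_attained[of "\<lambda>n. almost_all_samples m n (\<lambda>Y. \<exists>P. is_mle ?M Y P)" "nat (B + 1)"]
    by blast
  have uniq: "almost_all_samples m (nat C) (\<lambda>Y. \<exists>!P. is_mle ?M Y P)"
  proof -
    have less: "\<beta> s < \<alpha> s * nat C" if s: "s \<in> S" for s
    proof -
      \<comment> \<open>Already with \<open>C - 1\<close> samples the rows can be independent.\<close>
      have "\<beta> s + 1 \<le> (nat C - 1) + r s" "nat C - 1 \<ge> 1" using C[OF s] C2 by linarith+
      then obtain Y where "indep (cells m cv (nat C - 1) s) (prc E cv ce s) (parent_sum E ce Y)"
        using indep_samples_exist[OF dag, of cv ce s "nat C - 1"] unfolding \<beta>_def r_def by blast
      from indep_card_le[OF finite_cells finite_prc[OF dag] this]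
      have "\<beta> s \<le> \<alpha> s * (nat C - 1)" unfolding card_cells \<beta>_def beta_def \<alpha>_def .
      also have "\<dots> < \<alpha> s * nat C" using apos[OF s] C2 by simp
      finally show ?thesis .
    qed
    have "almost_all_samples m (nat C) (\<lambda>Y. \<forall>s\<in>S. indep (cells m cv (nat C) s) (prc E cv ce s) (parent_sum E ce Y))"
    proof (intro almost_all_ball almost_all_indep[OF dag])
      show "beta E cv ce s + 1 \<le> nat C + r_gen m E cv ce s" if "s \<in> S" for s
        using C[OF that] unfolding \<beta>_def r_def by linarith
    qed (use S C2 in auto)
    from almost_all_conj[OF exist[OF less] this] show ?thesis
    proof (rule almost_all_mono)
      fix Y assume "Y \<in> carrier_mat m (nat C)"
        "(\<forall>s\<in>S. \<not> in_span (cells m cv (nat C) s) (prc E cv ce s) (parent_sum E ce Y) (\<lambda>x. Y $$ x)) \<and>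
         (\<forall>s\<in>S. indep (cells m cv (nat C) s) (prc E cv ce s) (parent_sum E ce Y))"
      thus "\<exists>!P. is_mle ?M Y P"
        using C2 by (intro mle_exists(2)[OF dag comp]) (auto simp: S_def)
    qed
  qed
  moreover have "nat C \<ge> 1" using C2 by simp
  ultimately obtain nu where nu: "mlt_u m E cv ce = enat nu" "nu \<ge> 1"
    "almost_all_samples m nu (\<lambda>Y. \<exists>!P. is_mle ?M Y P)" "nu \<le> nat C"
    unfolding mlt_u_def
    using threshold_attained[of "\<lambda>n. almost_all_samples m n (\<lambda>Y. \<exists>!P. is_mle ?M Y P)" "nat C"]
    by blast
  have lower_u: "B + 1 \<le> int nu"
  proof -
    obtain Y where Y: "Y \<in> carrier_mat m nu" "\<exists>!P. is_mle ?M Y P" using almost_all_imp_ex[OF nu(3)] by blast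
    have "\<lfloor>real (\<beta> s) / real (\<alpha> s)\<rfloor> < int nu" if "s \<in> S" for s
      using unique_mle_imp_beta_less[OF dag comp Y(1) _ Y(2), of s] that floor_less_iff'[OF that]
      unfolding S_def \<alpha>_def \<beta>_def by blast
    hence "B < int nu" unfolding B_def using S by (subst Max_less_iff) auto
    thus ?thesis by simp
  qed
  have lower_e: "\<lfloor>(real (r s) - 1) / (real (\<alpha> s) - 1)\<rfloor> + 1 \<le> int ne" if s: "s \<in> S" "\<alpha> s \<ge> 2" for s
  proof (cases "r s = \<alpha> s")
    case False
    hence "(real (r s) - 1) / (real (\<alpha> s) - 1) < 1" using rle(1)[of s] s by (simp add: divide_less_eq)
    hence "\<lfloor>(real (r s) - 1) / (real (\<alpha> s) - 1)\<rfloor> < 1" by (simp add: floor_less_iff)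
    thus ?thesis using ne(2) by linarith
  next
    case True
    have "ne \<noteq> 1"
    proof
      assume "ne = 1"
      have "almost_all_samples m 1 (\<lambda>Y. \<exists>P. is_mle ?M Y P)" using ne(3) \<open>ne = 1\<close> by simp
      moreover have "almost_all_samples m 1 (\<lambda>Y. \<forall>P. \<not> is_mle ?M Y P)"
      proof (rule almost_all_mono[OF r_gen_eq_alpha_in_span[OF dag, where g = "\<lambda>Y x. Y $$ x"]])
        show "r_gen m E cv ce s = alpha m cv s" using True unfolding r_def \<alpha>_def .
        show "\<forall>P. \<not> is_mle ?M Y P" if "Y \<in> carrier_mat m 1"
          "in_span (cells m cv 1 s) (prc E cv ce s) (parent_sum E ce Y) (\<lambda>x. Y $$ x)" for Y
          using no_mle_if_in_span[OF dag comp that(1) _ that(2)] s(1) unfolding S_def by blast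
      qed
      ultimately show False using almost_all_imp_ex[OF almost_all_conj] by blast
    qed
    moreover have "(real (r s) - 1) / (real (\<alpha> s) - 1) = 1" using True s by simp
    ultimately show ?thesis using ne(2) by simp
  qed
  show ?thesis
    unfolding B_def[symmetric] C_def[symmetric]
  proof (rule exI[of _ ne], rule exI[of _ nu], intro conjI impI)
    assume "{s \<in> S. \<alpha> s \<ge> 2} \<noteq> {}"
    thus "Max ((\<lambda>s. \<lfloor>(real (r s) - 1) / (real (\<alpha> s) - 1)\<rfloor> + 1) ` {s \<in> S. \<alpha> s \<ge> 2}) \<le> int ne"
      using S(1) lower_e by (subst Max_le_iff) auto
  qed (use ne nu lower_u B0 C2 in auto)
qed

end
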